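(* Let $\Omega\subset\mathbb{R}^3$ be a polyhedral domain and let $\mathcal{T}_0,\mathcal{T}_1,\dots$ be a sequence of triangulations of $\Omega$ produced by the BEK local 3D red-green refinement procedure (conditions (1)--(6) of the context). For each $j$, let $\mathcal{N}_j$ be the set of interior nodes of $\mathcal{T}_j$, $\phi_i^{(j)}$ ($x_i\in\mathcal{N}_j$) the nodal basis of $\mathcal{S}_j$, and $$\hat\phi_i^{(j)}=2^{\frac{3}{2}L_{j,i}}\phi_i^{(j)},\qquad L_{j,i}=\min\{L(\tau):\tau\in\mathcal{T}_j,\ x_i\in\tau\},$$ the scaled basis. Then the scaled basis is an $L_2$-stable Riesz basis: for all $j$ and all real coefficients $(\hat u_i)_{x_i\in\mathcal{N}_j}$, $$\Bigl\|\sum_{x_i\in\mathcal{N}_j}\hat u_i\hat\phi_i^{(j)}\Bigr\|_{L_2(\Omega)}\;\eqsim\;\bigl\|\{\hat u_i\}_{x_i\in\mathcal{N}_j}\bigr\|_{\ell_2},$$ where $\eqsim$ means two-sided inequalities with positive constants independent of $j$ and of the coefficients.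
   Context: Triangulations. Each $\mathcal{T}_j$ is a finite collection of tetrahedra with mutually disjoint interiors whose union covers (the closure of) $\Omega$. The initial triangulation $\mathcal{T}_0$ is conforming, shape regular and quasiuniform. $\mathcal{T}_{j+1}$ is obtained from $\mathcal{T}_j$ by refining some of its tetrahedra; the resulting subtetrahedra are the sons, the refined tetrahedron is their father (an unrefined tetrahedron is carried over unchanged to $\mathcal{T}_{j+1}$). A regular (red) refinement of a tetrahedron bisects all six edges and divides it into 8 subtetrahedra of equal volume: four congruent corner subtetrahedra similar to the father are cut off, and the remaining octahedron is cut into four further tetrahedra using one diagonal, the diagonal being chosen so that successive refinements remain nondegenerate. An irregular (green) refinement is a subdivision into tetrahedra with corners among the vertices and edge midpoints of the father in which at least one, but not all six, edges are refined; it is used to restore conformity. Sons of an irregular refinement are called irregular tetrahedra. The level of a tetrahedron is $L(\tau)=\min\{j:\tau\in\mathcal{T}_j\}$. BEK conditions: (1) Nestedness: each $\tau\in\mathcal{T}_j$ is covered by exactly one $\tau'\in\mathcal{T}_{j-1}$, and any corner of $\tau$ is a corner or an edge midpoint of $\tau'$. (2) Conformity: the intersection of any two tetrahedra in $\mathcal{T}_j$ is empty, a common vertex, a common edge or a common face. (3) Nondegeneracy: the interior angles of all tetrahedra in the sequence $\mathcal{T}_0,\mathcal{T}_1,\dots$ are bounded away from zero (uniform shape regularity). (4) Irregular tetrahedra are not refined further. (5) Only tetrahedra $\tau\in\mathcal{T}_j$ with $L(\tau)=j$ are refined in the construction of $\mathcal{T}_{j+1}$. (6) If three or more edges of a tetrahedron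 are refined and do not belong to a common face, then the tetrahedron is refined regularly. Finite element spaces. $\mathcal{S}_j$ is the space of continuous functions on $\Omega$ that are affine on each $\tau\in\mathcal{T}_j$ and vanish on $\partial\Omega$; $\phi_i^{(j)}\in\mathcal{S}_j$ equals $1$ at $x_i$ and $0$ at all other nodes of $\mathcal{T}_j$. *)

theory Defs
  imports "HOL-Analysis.Analysis"
begin

section \<open>Polyhedral domains and tetrahedra\<close>

definition polyhedral_domain :: "(real^3) set \<Rightarrow> bool" where
  "polyhedral_domain \<Omega> \<longleftrightarrow>
     open \<Omega> \<and> connected \<Omega> \<and> \<Omega> \<noteq> {} \<and> bounded \<Omega> \<and>
     (\<exists>\<P>. finite \<P> \<and> (\<forall>F\<in>\<P>. polytope F \<and> aff_dim F = 2) \<and> frontier \<Omega> = \<Union>\<P>)"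

text \<open>A (closed, nondegenerate) tetrahedron is a set \<open>\<tau>\<close> with \<open>3 simplex \<tau>\<close>.\<close>

definition corners :: "(real^3) set \<Rightarrow> (real^3) set" where
  "corners \<tau> = {v. v extreme_point_of \<tau>}"

text \<open>\<open>e edge_of \<tau>\<close> forces \<open>aff_dim e = 1\<close>, so degenerate segments are excluded below.\<close>

definition edge_midpoints :: "(real^3) set \<Rightarrow> (real^3) set" where
  "edge_midpoints \<tau> = {midpoint a b | a b. closed_segment a b edge_of \<tau>}"

definition tetrahedral_mesh :: "(real^3) set \<Rightarrow> (real^3) set set \<Rightarrow> bool" where
  "tetrahedral_mesh D \<T> \<longleftrightarrow>
     finite \<T> \<and> (\<forall>\<tau>\<in>\<T>. 3 simplex \<tau>) \<and>
     (\<forall>\<sigma>\<in>\<T>. \<forall>\<tau>\<in>\<T>. \<sigma> \<noteq> \<tau> \<longrightarrow> interior \<sigma> \<inter> interior \<tau> = {}) \<and>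
     \<Union>\<T> = D"

text \<open>The faces of a tetrahedron in the sense of \<open>face_of\<close> are the empty set, its corners,
  edges and triangular faces, and the tetrahedron itself; the last case cannot occur for two
  different tetrahedra with disjoint interiors.\<close>

definition conforming :: "(real^3) set set \<Rightarrow> bool" where
  "conforming \<T> \<longleftrightarrow>
     (\<forall>\<sigma>\<in>\<T>. \<forall>\<tau>\<in>\<T>. (\<sigma> \<inter> \<tau>) face_of \<sigma> \<and> (\<sigma> \<inter> \<tau>) face_of \<tau>)"


section \<open>Interior angles and shape regularity\<close>

definition vec_angle :: "real^3 \<Rightarrow> real^3 \<Rightarrow> real" where
  "vec_angle u v = arccos ((u \<bullet> v) / (norm u * norm v))"

text \<open>The component of \<open>v\<close> orthogonal to \<open>e\<close>.\<close>

definition orth_part :: "real^3 \<Rightarrow> real^3 \<Rightarrow> real^3" where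
  "orth_part e v = v - ((v \<bullet> e) / (e \<bullet> e)) *\<^sub>R e"

text \<open>The interior angles of a tetrahedron are the plane angles of its triangular faces and
  the dihedral angles between its faces.  Neither family alone controls the shape: needles
  have dihedral angles bounded below, and slivers have face angles bounded below.\<close>

definition face_angles :: "(real^3) set \<Rightarrow> real set" where
  "face_angles \<tau> =
     {vec_angle (b - a) (c - a) | a b c. distinct [a, b, c] \<and> {a, b, c} \<subseteq> corners \<tau>}"

text \<open>The angle at the edge \<open>ab\<close> between the faces \<open>abc\<close> and \<open>abd\<close>.\<close>

definition dihedral_angles :: "(real^3) set \<Rightarrow> real set" where
  "dihedral_angles \<tau> =
     {vec_angle (orth_part (b - a) (c - a)) (orth_part (b - a) (d - a)) | a b c d.
        distinct [a, b, c, d] \<and> {a, b, c, d} = corners \<tau>}"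

definition interior_angles :: "(real^3) set \<Rightarrow> real set" where
  "interior_angles \<tau> = face_angles \<tau> \<union> dihedral_angles \<tau>"

definition shape_regular :: "(real^3) set set \<Rightarrow> bool" where
  "shape_regular \<T> \<longleftrightarrow> (\<exists>\<alpha>>0. \<forall>\<tau>\<in>\<T>. \<forall>\<theta>\<in>interior_angles \<tau>. \<alpha> \<le> \<theta>)"

definition quasiuniform :: "(real^3) set set \<Rightarrow> bool" where
  "quasiuniform \<T> \<longleftrightarrow> (\<exists>C>0. \<forall>\<sigma>\<in>\<T>. \<forall>\<tau>\<in>\<T>. diameter \<sigma> \<le> C * diameter \<tau>)"


section \<open>Regular and irregular refinement of a tetrahedron\<close>

text \<open>The four corner tetrahedra are cut off; the remaining octahedron is cut along the
  diagonal joining the midpoints of the opposite edges \<open>ab\<close> and \<open>cd\<close>.  Since \<open>a, b, c, d\<close>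
  may be any enumeration of the corners, each of the three diagonals is admitted here; the
  requirement that the choices keep the sequence of meshes nondegenerate is a condition on
  the whole sequence (see \<open>BEK_sequence\<close>).\<close>

definition regular_refinement :: "(real^3) set \<Rightarrow> (real^3) set set \<Rightarrow> bool" where
  "regular_refinement \<tau> R \<longleftrightarrow>
     (\<exists>a b c d. distinct [a, b, c, d] \<and> corners \<tau> = {a, b, c, d} \<and>
        R = {convex hull {a, midpoint a b, midpoint a c, midpoint a d},
             convex hull {b, midpoint a b, midpoint b c, midpoint b d},
             convex hull {c, midpoint a c, midpoint b c, midpoint c d},
             convex hull {d, midpoint a d, midpoint b d, midpoint c d},
             convex hull {midpoint a b, midpoint c d, midpoint a c, midpoint a d},
             convex hull {midpoint a b, midpoint c d, midpoint a d, midpoint b d},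
             convex hull {midpoint a b, midpoint c d, midpoint b d, midpoint b c},
             convex hull {midpoint a b, midpoint c d, midpoint b c, midpoint a c}})"

text \<open>The edges of \<open>\<tau>\<close> that are refined when \<open>\<tau>\<close> is replaced by the tetrahedra in \<open>R\<close>.\<close>

definition refined_edges :: "(real^3) set \<Rightarrow> (real^3) set set \<Rightarrow> (real^3) set set" where
  "refined_edges \<tau> R =
     {closed_segment a b | a b.
        closed_segment a b edge_of \<tau> \<and> midpoint a b \<in> \<Union>(corners ` R)}"

definition irregular_refinement :: "(real^3) set \<Rightarrow> (real^3) set set \<Rightarrow> bool" where
  "irregular_refinement \<tau> R \<longleftrightarrow>
     tetrahedral_mesh \<tau> R \<and>
     (\<forall>\<sigma>\<in>R. corners \<sigma> \<subseteq> corners \<tau> \<union> edge_midpoints \<tau>) \<and>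
     refined_edges \<tau> R \<noteq> {} \<and> refined_edges \<tau> R \<noteq> {e. e edge_of \<tau>}"


section \<open>Sequences of meshes\<close>

text \<open>For an unrefined \<open>\<tau>\<close> (one carried over to \<open>\<T> (Suc j)\<close>) this set is \<open>{\<tau>}\<close>.\<close>

definition sons :: "(nat \<Rightarrow> (real^3) set set) \<Rightarrow> nat \<Rightarrow> (real^3) set \<Rightarrow> (real^3) set set" where
  "sons \<T> j \<tau> = {\<sigma> \<in> \<T> (Suc j). \<sigma> \<subseteq> \<tau>}"

definition level :: "(nat \<Rightarrow> (real^3) set set) \<Rightarrow> (real^3) set \<Rightarrow> nat" where
  "level \<T> \<tau> = (LEAST j. \<tau> \<in> \<T> j)"

definition irregular_tetrahedron :: "(nat \<Rightarrow> (real^3) set set) \<Rightarrow> (real^3) set \<Rightarrow> bool" where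
  "irregular_tetrahedron \<T> \<sigma> \<longleftrightarrow>
     (\<exists>j. \<exists>\<tau>\<in>\<T> j. irregular_refinement \<tau> (sons \<T> j \<tau>) \<and> \<sigma> \<in> sons \<T> j \<tau>)"

definition refinement_step :: "(nat \<Rightarrow> (real^3) set set) \<Rightarrow> nat \<Rightarrow> bool" where
  "refinement_step \<T> j \<longleftrightarrow>
     (\<forall>\<tau>\<in>\<T> j. \<tau> \<in> \<T> (Suc j) \<or>
        regular_refinement \<tau> (sons \<T> j \<tau>) \<or> irregular_refinement \<tau> (sons \<T> j \<tau>))"

definition nested :: "(nat \<Rightarrow> (real^3) set set) \<Rightarrow> bool" where
  "nested \<T> \<longleftrightarrow>
     (\<forall>j. \<forall>\<sigma>\<in>\<T> (Suc j).
        (\<exists>!\<tau>. \<tau> \<in> \<T> j \<and> \<sigma> \<subseteq> \<tau>) \<and>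
        (\<forall>\<tau>\<in>\<T> j. \<sigma> \<subseteq> \<tau> \<longrightarrow> corners \<sigma> \<subseteq> corners \<tau> \<union> edge_midpoints \<tau>))"

definition irregular_not_refined :: "(nat \<Rightarrow> (real^3) set set) \<Rightarrow> bool" where
  "irregular_not_refined \<T> \<longleftrightarrow>
     (\<forall>j. \<forall>\<tau>\<in>\<T> j. irregular_tetrahedron \<T> \<tau> \<longrightarrow> \<tau> \<in> \<T> (Suc j))"

definition only_newest_refined :: "(nat \<Rightarrow> (real^3) set set) \<Rightarrow> bool" where
  "only_newest_refined \<T> \<longleftrightarrow>
     (\<forall>j. \<forall>\<tau>\<in>\<T> j. \<tau> \<notin> \<T> (Suc j) \<longrightarrow> level \<T> \<tau> = j)"

definition many_edges_regular :: "(nat \<Rightarrow> (real^3) set set) \<Rightarrow> bool" where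
  "many_edges_regular \<T> \<longleftrightarrow>
     (\<forall>j. \<forall>\<tau>\<in>\<T> j.
        card (refined_edges \<tau> (sons \<T> j \<tau>)) \<ge> 3 \<and>
        \<not> (\<exists>F. F facet_of \<tau> \<and> (\<forall>e\<in>refined_edges \<tau> (sons \<T> j \<tau>). e \<subseteq> F))
        \<longrightarrow> regular_refinement \<tau> (sons \<T> j \<tau>))"

definition BEK_sequence :: "(real^3) set \<Rightarrow> (nat \<Rightarrow> (real^3) set set) \<Rightarrow> bool" where
  "BEK_sequence \<Omega> \<T> \<longleftrightarrow>
     (\<forall>j. tetrahedral_mesh (closure \<Omega>) (\<T> j)) \<and>
     conforming (\<T> 0) \<and> shape_regular (\<T> 0) \<and> quasiuniform (\<T> 0) \<and>
     (\<forall>j. refinement_step \<T> j) \<and>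
     nested \<T> \<and>
     (\<forall>j. conforming (\<T> j)) \<and>
     shape_regular (\<Union>j. \<T> j) \<and>
     irregular_not_refined \<T> \<and>
     only_newest_refined \<T> \<and>
     many_edges_regular \<T>"


section \<open>Finite element spaces and the scaled nodal basis\<close>

definition nodes :: "(real^3) set set \<Rightarrow> (real^3) set" where
  "nodes \<T> = \<Union>(corners ` \<T>)"

definition interior_nodes :: "(real^3) set \<Rightarrow> (real^3) set set \<Rightarrow> (real^3) set" where
  "interior_nodes \<Omega> \<T> = nodes \<T> \<inter> \<Omega>"

text \<open>Functions are total on \<open>real^3\<close>; their values off \<open>closure \<Omega>\<close> are irrelevant.\<close>

definition fe_space :: "(real^3) set \<Rightarrow> (real^3) set set \<Rightarrow> (real^3 \<Rightarrow> real) set" where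
  "fe_space \<Omega> \<T> =
     {f. continuous_on (closure \<Omega>) f \<and>
         (\<forall>\<tau>\<in>\<T>. \<exists>a b. \<forall>x\<in>\<tau>. f x = a \<bullet> x + b) \<and>
         (\<forall>x\<in>frontier \<Omega>. f x = 0)}"

text \<open>The basis function belonging to the node \<open>x\<close> is \<open>\<phi> x\<close>; on \<open>closure \<Omega>\<close> it is
  determined by this property.\<close>

definition nodal_basis ::
    "(real^3) set \<Rightarrow> (real^3) set set \<Rightarrow> (real^3 \<Rightarrow> real^3 \<Rightarrow> real) \<Rightarrow> bool" where
  "nodal_basis \<Omega> \<T> \<phi> \<longleftrightarrow>
     (\<forall>x\<in>interior_nodes \<Omega> \<T>.
        \<phi> x \<in> fe_space \<Omega> \<T> \<and> \<phi> x x = 1 \<and> (\<forall>y\<in>nodes \<T> - {x}. \<phi> x y = 0))"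

definition node_level :: "(nat \<Rightarrow> (real^3) set set) \<Rightarrow> nat \<Rightarrow> real^3 \<Rightarrow> nat" where
  "node_level \<T> j x = Min (level \<T> ` {\<tau> \<in> \<T> j. x \<in> \<tau>})"

definition scaled_basis ::
    "(nat \<Rightarrow> (real^3) set set) \<Rightarrow> (nat \<Rightarrow> real^3 \<Rightarrow> real^3 \<Rightarrow> real) \<Rightarrow>
     nat \<Rightarrow> real^3 \<Rightarrow> real^3 \<Rightarrow> real" where
  "scaled_basis \<T> \<phi> j x y = 2 powr (3/2 * real (node_level \<T> j x)) * \<phi> j x y"

definition L2_norm :: "(real^3) set \<Rightarrow> (real^3 \<Rightarrow> real) \<Rightarrow> real" where
  "L2_norm \<Omega> f = sqrt (LINT y:\<Omega>|lborel. (f y)\<^sup>2)"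

end

theory Submission
  imports Defs
begin

text \<open>On a tetrahedron \<open>\<tau>\<close> the squared \<open>L2\<close> norm of an affine function is comparable to the volume
  of \<open>\<tau>\<close> times the sum of its squared corner values.  Hence the squared norm of
  \<open>\<Sum>\<^sub>x u x * scaled_basis \<T> \<phi> j x\<close> is comparable to the sum over \<open>x\<close> of
  \<open>(u x)\<^sup>2 * 8 ^ node_level \<T> j x\<close> times the volume of the star of \<open>x\<close>, and it remains to see that
  this volume is comparable to \<open>8 ^ - node_level \<T> j x\<close>.  Irregular tetrahedra are never refined and
  only the newest ones are, so a tetrahedron of level \<open>L\<close> arises by \<open>L - 1\<close> regular refinements
  and at most one further refinement, whose sons have at least an eighth of the father's volume;
  its volume is thus comparable to \<open>8 ^ - L\<close>.  By shape regularity the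
  cube of its diameter is bounded by its volume, which confines the star of a node to a small
  ball.\<close>

unbundle cross3_syntax

subsection \<open>Volumes of tetrahedra and of their sons\<close>

text \<open>Six times the signed volume, as a scalar triple product. Being a polynomial in the
  corner coordinates, it turns comparisons of volumes into algebra.\<close>

definition vol6 :: "real^3 \<Rightarrow> real^3 \<Rightarrow> real^3 \<Rightarrow> real^3 \<Rightarrow> real" where
  "vol6 a b c d = (b - a) \<bullet> ((c - a) \<times> (d - a))"

lemma content_tetrahedron:
  assumes "distinct [a, b, c, d]"
  shows "measure lborel (convex hull {a, b, c, d}) = \<bar>vol6 a b c d\<bar> / 6"
proof -
  define f :: "3 \<Rightarrow> real^3" where "f = (\<lambda>i. if i = 1 then b else if i = 2 then c else d)"
  have bij: "bij_betw f UNIV ({a, b, c, d} - {a})"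
    unfolding bij_betw_def inj_on_def UNIV_3 f_def using assms by auto
  have "measure lborel (convex hull {a, b, c, d}) =
      \<bar>det (\<chi> i j. f j $ i - a $ i :: real^3^3)\<bar> / fact CARD(3)"
    by (rule content_simplex[OF _ _ _ bij]) (use assms in auto)
  moreover have "det (\<chi> i j. f j $ i - a $ i :: real^3^3) = vol6 a b c d"
    unfolding vol6_def f_def by (simp add: cross3_simps)
  ultimately show ?thesis by (simp add: fact_numeral)
qed

lemma simplex_cornersE:
  assumes "3 simplex \<tau>"
  obtains a b c d where "distinct [a, b, c, d]" "corners \<tau> = {a, b, c, d}"
    "\<tau> = convex hull {a, b, c, d}"
proof -
  obtain C where C: "finite C" "\<not> affine_dependent C" "int (card C) = 3 + 1" "\<tau> = convex hull C"
    using assms unfolding simplex by blast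
  have "card C = Suc (Suc (Suc (Suc 0)))" using C(3) by simp
  then obtain a b c d where abcd: "distinct [a, b, c, d]" "C = {a, b, c, d}"
    by (auto simp: card_Suc_eq)
  have "corners \<tau> = C"
    unfolding corners_def C(4) by (simp add: extreme_point_of_convex_hull_affine_independent C(2))
  with abcd C show ?thesis by (intro that[of a b c d]) auto
qed

text \<open>A 3-simplex is full-dimensional, so its interior is its nonempty relative interior, and
  a convex set with interior points is not negligible.\<close>

lemma simplex_content_pos:
  assumes "3 simplex (\<tau> :: (real^3) set)"
  shows "interior \<tau> \<noteq> {}" "0 < measure lborel \<tau>"
proof -
  have "aff_dim \<tau> = 3" using assms aff_dim_simplex by blast
  then have "affine hull \<tau> = UNIV" by (simp add: aff_dim_eq_full[symmetric])
  then have "interior \<tau> = rel_interior \<tau>" by (simp add: rel_interior_interior)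
  moreover have "\<tau> \<noteq> {}" using assms by auto
  ultimately show 1: "interior \<tau> \<noteq> {}"
    using rel_interior_eq_empty[OF convex_simplex[OF assms]] by simp
  have "\<tau> \<in> lmeasurable"
    using compact_simplex[OF assms] by (rule lmeasurable_compact)
  then have "measure lebesgue \<tau> \<noteq> 0"
    using 1 negligible_convex_interior[OF convex_simplex[OF assms]] negligible_iff_measure by blast
  then show "0 < measure lborel \<tau>"
    using compact_simplex[OF assms] 
    by (metis borel_compact measure_completion measure_nonneg order_le_less sets_lborel)
qed

lemma vol6_nonzero:
  assumes "3 simplex (convex hull {a, b, c, d})" "distinct [a, b, c, d]"
  shows "vol6 a b c d \<noteq> 0"
  using simplex_content_pos(2)[OF assms(1)] content_tetrahedron[OF assms(2)] by auto

lemmas vol6_unfold = vol6_def midpoint_def cross3_simps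

text \<open>The corners stand in the order used by \<open>regular_refinement\<close>; in that order
  the sons at \<open>b\<close> and \<open>d\<close> have reversed orientation, hence the minus
  signs.\<close>

lemma vol6_sons:
  "vol6 a (midpoint a b) (midpoint a c) (midpoint a d) = vol6 a b c d / 8"
  "vol6 b (midpoint a b) (midpoint b c) (midpoint b d) = - vol6 a b c d / 8"
  "vol6 c (midpoint a c) (midpoint b c) (midpoint c d) = vol6 a b c d / 8"
  "vol6 d (midpoint a d) (midpoint b d) (midpoint c d) = - vol6 a b c d / 8"
  "vol6 (midpoint a b) (midpoint c d) (midpoint a c) (midpoint a d) = vol6 a b c d / 8"
  "vol6 (midpoint a b) (midpoint c d) (midpoint a d) (midpoint b d) = vol6 a b c d / 8"
  "vol6 (midpoint a b) (midpoint c d) (midpoint b d) (midpoint b c) = vol6 a b c d / 8"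
  "vol6 (midpoint a b) (midpoint c d) (midpoint b c) (midpoint a c) = vol6 a b c d / 8"
  by (simp_all add: vol6_unfold field_simps)

section \<open>The half-integer lattice of corners and edge midpoints\<close>

lemma edge_midpointsE:
  assumes "p \<in> corners \<tau> \<union> edge_midpoints \<tau>"
  obtains x y where "x \<in> corners \<tau>" "y \<in> corners \<tau>" "p = midpoint x y"
  using assms
proof
  assume "p \<in> corners \<tau>"
  \<comment> \<open>A corner counts as the midpoint of itself with itself, so that both kinds of
    points have one form.\<close>
  then show ?thesis by (intro that[of p p]) auto
next
  assume "p \<in> edge_midpoints \<tau>"
  then obtain x y where "closed_segment x y face_of \<tau>" "p = midpoint x y"
    unfolding edge_midpoints_def edge_of_def by auto
  then show ?thesis
    using that extreme_point_of_face[of "closed_segment x y" \<tau>] 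
    by (auto simp: corners_def extreme_point_of_segment)
qed

text \<open>Relative to \<open>a\<close>, each corner has coordinates 0 or 1 in the frame of the
  edges at \<open>a\<close>; doubling a midpoint adds two such vectors and clears the
  denominator.\<close>

lemma half_lattice_point:
  fixes a b c d :: "real^3"
  assumes "x \<in> {a, b, c, d}" "y \<in> {a, b, c, d}"
  shows "\<exists>i j k :: int. 2 *\<^sub>R (midpoint x y - a) =
    of_int i *\<^sub>R (b - a) + of_int j *\<^sub>R (c - a) + of_int k *\<^sub>R (d - a)"
proof -
  have corner: "\<exists>i j k :: int. z - a =
    of_int i *\<^sub>R (b - a) + of_int j *\<^sub>R (c - a) + of_int k *\<^sub>R (d - a)"
    if "z \<in> {a, b, c, d}" for z
  proof -
    consider "z = a" | "z = b" | "z = c" | "z = d" using \<open>z \<in> _\<close> by blast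
    then show ?thesis
    proof cases
      case 1 show ?thesis by (rule exI[of _ 0], rule exI[of _ 0], rule exI[of _ 0]) (simp add: 1)
    next
      case 2 show ?thesis by (rule exI[of _ 1], rule exI[of _ 0], rule exI[of _ 0]) (simp add: 2)
    next
      case 3 show ?thesis by (rule exI[of _ 0], rule exI[of _ 1], rule exI[of _ 0]) (simp add: 3)
    next
      case 4 show ?thesis by (rule exI[of _ 0], rule exI[of _ 0], rule exI[of _ 1]) (simp add: 4)
    qed
  qed
  from corner[OF assms(1)] obtain i j k :: int where
    x: "x - a = of_int i *\<^sub>R (b - a) + of_int j *\<^sub>R (c - a) + of_int k *\<^sub>R (d - a)" by blast
  from corner[OF assms(2)] obtain i' j' k' :: int where
    y: "y - a = of_int i' *\<^sub>R (b - a) + of_int j' *\<^sub>R (c - a) + of_int k' *\<^sub>R (d - a)" by blast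
  have "2 *\<^sub>R (midpoint x y - a) = (x - a) + (y - a)"
    by (simp add: midpoint_def algebra_simps scaleR_2)
  also have "\<dots> = of_int (i + i') *\<^sub>R (b - a) + of_int (j + j') *\<^sub>R (c - a) + of_int (k + k') *\<^sub>R (d - a)"
    unfolding x y by (simp add: scaleR_left_distrib)
  finally show ?thesis by blast
qed

text \<open>The triple product is trilinear and alternating, so the determinant of the coefficient
  matrix factors out.\<close>

lemma triple_product_combination:
  fixes u v w :: "real^3"
  shows "(x1 *\<^sub>R u + y1 *\<^sub>R v + z1 *\<^sub>R w) \<bullet>
      ((x2 *\<^sub>R u + y2 *\<^sub>R v + z2 *\<^sub>R w) \<times> (x3 *\<^sub>R u + y3 *\<^sub>R v + z3 *\<^sub>R w)) =
    (x1 * (y2 * z3 - z2 * y3) - y1 * (x2 * z3 - z2 * x3) + z1 * (x2 * y3 - y2 * x3)) *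
      (u \<bullet> (v \<times> w))"
proof -
  have "u \<bullet> (w \<times> v) = - (u \<bullet> (v \<times> w))" "v \<bullet> (u \<times> w) = - (u \<bullet> (v \<times> w))"
    "v \<bullet> (w \<times> u) = u \<bullet> (v \<times> w)" "w \<bullet> (u \<times> v) = u \<bullet> (v \<times> w)"
    "w \<bullet> (v \<times> u) = - (u \<bullet> (v \<times> w))"
    by (simp_all add: cross3_simps)
  then show ?thesis
    by (simp add: inner_add_left inner_add_right cross_add_left cross_add_right cross_mult_left
      cross_mult_right dot_cross_self algebra_simps)
qed

text \<open>Doubling turns the three edge vectors at \<open>p\<close> into integer combinations of
  those at \<open>a\<close>, so the triple product picks up an integer determinant. The 8 is one
  factor 2 for each vector.\<close>

lemma vol6_half_lattice:
  assumes "corners \<tau> = {a, b, c, d}"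
    and sub: "{p, q, r, s} \<subseteq> corners \<tau> \<union> edge_midpoints \<tau>"
  shows "\<exists>m :: int. 8 * vol6 p q r s = of_int m * vol6 a b c d"
proof -
  have lattice: "\<exists>i j k :: int. 2 *\<^sub>R (z - a) =
    of_int i *\<^sub>R (b - a) + of_int j *\<^sub>R (c - a) + of_int k *\<^sub>R (d - a)"
    if "z \<in> {p, q, r, s}" for z
  proof -
    have "z \<in> corners \<tau> \<union> edge_midpoints \<tau>" using that sub by blast
    then obtain x y where "x \<in> corners \<tau>" "y \<in> corners \<tau>" "z = midpoint x y"
      by (rule edge_midpointsE)
    then show ?thesis using half_lattice_point[of x a b c d y] unfolding assms(1) by simp
  qed
  have diff: "\<exists>i j k :: int. 2 *\<^sub>R (z - p) =
    of_int i *\<^sub>R (b - a) + of_int j *\<^sub>R (c - a) + of_int k *\<^sub>R (d - a)"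
    if "z \<in> {p, q, r, s}" for z
  proof -
    from lattice[OF that] obtain i j k :: int where
      z: "2 *\<^sub>R (z - a) = of_int i *\<^sub>R (b - a) + of_int j *\<^sub>R (c - a) + of_int k *\<^sub>R (d - a)" by blast
    from lattice[of p] obtain i' j' k' :: int where
      p: "2 *\<^sub>R (p - a) = of_int i' *\<^sub>R (b - a) + of_int j' *\<^sub>R (c - a) + of_int k' *\<^sub>R (d - a)" by blast
    have "2 *\<^sub>R (z - p) = 2 *\<^sub>R (z - a) - 2 *\<^sub>R (p - a)" by (simp add: algebra_simps)
    also have "\<dots> = of_int (i - i') *\<^sub>R (b - a) + of_int (j - j') *\<^sub>R (c - a) + of_int (k - k') *\<^sub>R (d - a)"
      unfolding z p by (simp add: scaleR_left_diff_distrib)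
    finally show ?thesis by blast
  qed
  obtain x1 y1 z1 :: int where q: "2 *\<^sub>R (q - p) =
    of_int x1 *\<^sub>R (b - a) + of_int y1 *\<^sub>R (c - a) + of_int z1 *\<^sub>R (d - a)" using diff[of q] by blast
  obtain x2 y2 z2 :: int where r: "2 *\<^sub>R (r - p) =
    of_int x2 *\<^sub>R (b - a) + of_int y2 *\<^sub>R (c - a) + of_int z2 *\<^sub>R (d - a)" using diff[of r] by blast
  obtain x3 y3 z3 :: int where s: "2 *\<^sub>R (s - p) =
    of_int x3 *\<^sub>R (b - a) + of_int y3 *\<^sub>R (c - a) + of_int z3 *\<^sub>R (d - a)" using diff[of s] by blast
  have "8 * vol6 p q r s = (2 *\<^sub>R (q - p)) \<bullet> ((2 *\<^sub>R (r - p)) \<times> (2 *\<^sub>R (s - p)))"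
    by (simp add: vol6_def cross_mult_left cross_mult_right)
  also have "\<dots> = of_int (x1 * (y2 * z3 - z2 * y3) - y1 * (x2 * z3 - z2 * x3) + z1 * (x2 * y3 - y2 * x3))
      * vol6 a b c d"
    unfolding q r s triple_product_combination vol6_def by simp
  finally show ?thesis by blast
qed

text \<open>The integer of \<open>vol6_half_lattice\<close> is nonzero because \<sigma> is
  nondegenerate, hence at least 1 in absolute value. This covers every irregular subdivision pattern
  at once.\<close>

lemma content_son_ge:
  assumes \<tau>: "3 simplex \<tau>" and \<sigma>: "3 simplex \<sigma>"
    and sub: "corners \<sigma> \<subseteq> corners \<tau> \<union> edge_midpoints \<tau>"
  shows "measure lborel \<tau> / 8 \<le> measure lborel \<sigma>"
proof -
  obtain a b c d where \<tau>': "distinct [a, b, c, d]" "corners \<tau> = {a, b, c, d}"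
    "\<tau> = convex hull {a, b, c, d}" using simplex_cornersE[OF \<tau>] by metis
  obtain p q r s where \<sigma>': "distinct [p, q, r, s]" "corners \<sigma> = {p, q, r, s}"
    "\<sigma> = convex hull {p, q, r, s}" using simplex_cornersE[OF \<sigma>] by metis
  obtain m :: int where m: "8 * vol6 p q r s = of_int m * vol6 a b c d"
    using vol6_half_lattice[OF \<tau>'(2)] sub \<sigma>'(2) by metis
  have "vol6 p q r s \<noteq> 0" using vol6_nonzero \<sigma> \<sigma>' by metis
  then have "m \<noteq> 0" using m by auto
  then have "1 \<le> \<bar>real_of_int m\<bar>" by linarith
  then have "1 * \<bar>vol6 a b c d\<bar> \<le> \<bar>real_of_int m\<bar> * \<bar>vol6 a b c d\<bar>" by (intro mult_right_mono) auto
  also have "\<dots> = 8 * \<bar>vol6 p q r s\<bar>" using m by (metis abs_mult abs_numeral)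
  finally show ?thesis
    unfolding \<tau>'(3) \<sigma>'(3) content_tetrahedron[OF \<tau>'(1)] content_tetrahedron[OF \<sigma>'(1)] by simp
qed

lemma content_regular_son:
  assumes \<tau>: "3 simplex \<tau>" and R: "regular_refinement \<tau> R" and "\<sigma> \<in> R" and \<sigma>: "3 simplex \<sigma>"
  shows "measure lborel \<sigma> = measure lborel \<tau> / 8"
proof -
  obtain a b c d where d: "distinct [a, b, c, d]" and c: "corners \<tau> = {a, b, c, d}" and Rs:
    "R = {convex hull {a, midpoint a b, midpoint a c, midpoint a d},
             convex hull {b, midpoint a b, midpoint b c, midpoint b d},
             convex hull {c, midpoint a c, midpoint b c, midpoint c d},
             convex hull {d, midpoint a d, midpoint b d, midpoint c d},
             convex hull {midpoint a b, midpoint c d, midpoint a c, midpoint a d},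
             convex hull {midpoint a b, midpoint c d, midpoint a d, midpoint b d},
             convex hull {midpoint a b, midpoint c d, midpoint b d, midpoint b c},
             convex hull {midpoint a b, midpoint c d, midpoint b c, midpoint a c}}"
    using R unfolding regular_refinement_def by (elim exE conjE) (rule that)
  have \<tau>': "\<tau> = convex hull {a, b, c, d}" using simplex_cornersE[OF \<tau>] c by metis
  have "measure lborel \<sigma> = \<bar>vol6 a b c d / 8\<bar> / 6"
    if "\<sigma> = convex hull {p, q, r, s}" "\<bar>vol6 p q r s\<bar> = \<bar>vol6 a b c d / 8\<bar>" for p q r s
  proof -
    \<comment> \<open>A repeated corner would make the triple product vanish, and with it the volume
      of the father.\<close>
    have "distinct [p, q, r, s]"
    proof (rule ccontr)
      assume "\<not> distinct [p, q, r, s]"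
      then have "vol6 p q r s = 0" by (auto simp: vol6_def dot_cross_self)
      then have "vol6 a b c d = 0" using that by simp
      then show False using vol6_nonzero \<tau> \<tau>' d by metis
    qed
    then show ?thesis using content_tetrahedron that by metis
  qed
  note * = this
  have "measure lborel \<sigma> = \<bar>vol6 a b c d / 8\<bar> / 6"
    using \<open>\<sigma> \<in> R\<close> unfolding Rs insert_iff empty_iff
    by (elim disjE FalseE) (erule *, simp add: vol6_sons)+
  then show ?thesis unfolding \<tau>' content_tetrahedron[OF d] by simp
qed

subsection \<open>Affine functions on a tetrahedron\<close>

text \<open>On the quarter-size copy of \<open>\<tau>\<close> at the corner where \<open>\<bar>f\<bar>\<close> is largest, the barycentric
  coordinate of that corner is at least \<open>3/4\<close>, so the affine \<open>f\<close> keeps half of its maximum.\<close>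
lemma affine_abs_le_vertex:
  fixes f :: "'a::euclidean_space \<Rightarrow> real"
  assumes f: "\<forall>x\<in>convex hull S. f x = g \<bullet> x + h"
    and v: "v \<in> S" and max: "\<And>w. w \<in> S \<Longrightarrow> \<bar>f w\<bar> \<le> \<bar>f v\<bar>"
    and x: "x \<in> convex hull S"
  shows "\<bar>f x\<bar> \<le> \<bar>f v\<bar>"
    and "(1/4) *\<^sub>R x + (3/4) *\<^sub>R v \<in> convex hull S"
    and "\<bar>f v\<bar> / 2 \<le> \<bar>f ((1/4) *\<^sub>R x + (3/4) *\<^sub>R v)\<bar>"
proof -
  show fx: "\<bar>f x\<bar> \<le> \<bar>f v\<bar>"
  proof -
    \<comment> \<open>The points where an affine function is bounded in absolute value form a slab;
      containing the corners, it contains their hull.\<close>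
    have "S \<subseteq> {z. \<bar>g \<bullet> z + h\<bar> \<le> \<bar>f v\<bar>}" using max f hull_inc by fastforce
    moreover have "convex {z. \<bar>g \<bullet> z + h\<bar> \<le> \<bar>f v\<bar>}"
    proof -
      have "{z. \<bar>g \<bullet> z + h\<bar> \<le> \<bar>f v\<bar>} = {z. g \<bullet> z \<le> \<bar>f v\<bar> - h} \<inter> {z. g \<bullet> z \<ge> - \<bar>f v\<bar> - h}" by auto
      then show ?thesis by (simp add: convex_Int convex_halfspace_le convex_halfspace_ge)
    qed
    ultimately have "convex hull S \<subseteq> {z. \<bar>g \<bullet> z + h\<bar> \<le> \<bar>f v\<bar>}" by (rule hull_minimal)
    then show ?thesis using x f by auto
  qed
  let ?y = "(1/4) *\<^sub>R x + (3/4) *\<^sub>R v"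
  have vh: "v \<in> convex hull S" using v by (rule hull_inc)
  show yh: "?y \<in> convex hull S"
    using vh x convex_convex_hull[of S] by (intro convexD) auto
  have "f ?y = g \<bullet> ?y + h" "f v = g \<bullet> v + h" "f x = g \<bullet> x + h" using f yh vh x by auto
  moreover have "g \<bullet> ?y = 3/4 * (g \<bullet> v) + 1/4 * (g \<bullet> x)" by (simp add: inner_add_right)
  ultimately have "f ?y = 3/4 * f v + 1/4 * f x" by linarith
  with fx show "\<bar>f v\<bar> / 2 \<le> \<bar>f ?y\<bar>" by linarith
qed

subsection \<open>Shape regularity and volume\<close>

text \<open>The cosine decreases on [0, \<pi>]. Multiplying out the quotient lets the bound cover
  zero vectors, where both sides are 0.\<close>

lemma inner_le_cos_vec_angle:
  assumes "0 < \<alpha>" "\<alpha> \<le> vec_angle u v"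
  shows "u \<bullet> v \<le> cos \<alpha> * (norm u * norm v)"
proof (cases "u = 0 \<or> v = 0")
  case False
  let ?q = "(u \<bullet> v) / (norm u * norm v)"
  have pos: "0 < norm u * norm v" using False by simp
  have "\<bar>?q\<bar> \<le> 1"
    using Cauchy_Schwarz_ineq2[of u v] pos by (simp add: abs_div divide_le_eq_1)
  then have q: "-1 \<le> ?q" "?q \<le> 1" by linarith+
  have "cos (arccos ?q) \<le> cos \<alpha>"
    using assms q arccos_ubound[of ?q] by (intro cos_monotone_0_pi_le) (auto simp: vec_angle_def)
  then have "?q \<le> cos \<alpha>" using q by (simp add: cos_arccos)
  then show ?thesis using pos by (simp add: divide_le_eq)
qed auto

text \<open>A lower bound on an angle bounds its cosine only from above; the sign condition excludes
  obtuse angles, so the cosine can be squared. By Lagrange's identity the right-hand side is the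
  squared norm of \<open>u \<times> v\<close>.\<close>

lemma sin_vec_angle_le:
  assumes "0 < \<alpha>" "\<alpha> \<le> vec_angle u v" "0 \<le> u \<bullet> v"
  shows "(sin \<alpha>)\<^sup>2 * ((norm u)\<^sup>2 * (norm v)\<^sup>2) \<le> (norm u)\<^sup>2 * (norm v)\<^sup>2 - (u \<bullet> v)\<^sup>2"
proof -
  have "(u \<bullet> v)\<^sup>2 \<le> (cos \<alpha> * (norm u * norm v))\<^sup>2"
    using inner_le_cos_vec_angle[OF assms(1,2)] assms(3) by (rule power_mono)
  then show ?thesis
    unfolding sin_squared_eq by (simp add: power_mult_distrib algebra_simps)
qed

section \<open>Dihedral angles and face normals\<close>

lemma cross_orth_part: "e \<times> orth_part e u = e \<times> u"
  by (simp add: orth_part_def Cross3.right_diff_distrib cross_mult_right)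

text \<open>\<open>orth_part e\<close> projects onto the plane orthogonal to \<open>e\<close>;
  crossing with \<open>e\<close> rotates that plane by a right angle and scales it by
  \<open>norm e\<close>. Hence the face normals at the edge \<open>e\<close> enclose the dihedral
  angle.\<close>

lemma inner_cross_orth_part:
  assumes "e \<noteq> 0"
  shows "(e \<times> u) \<bullet> (e \<times> v) = (norm e)\<^sup>2 * (orth_part e u \<bullet> orth_part e v)"
proof -
  have "orth_part e v \<bullet> e = 0" "e \<bullet> orth_part e v = 0"
    using assms by (simp_all add: orth_part_def inner_diff_left inner_diff_right inner_commute)
  then show ?thesis
    using dot_cross[of e "orth_part e u" e "orth_part e v"]
    by (simp add: cross_orth_part power2_norm_eq_inner)
qed

text \<open>The cross product of the two normals is \<open>e\<close> times the volume determinant,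
  while its norm is the product of the two parallelogram areas times the sine of the dihedral
  angle.\<close>

lemma dihedral_volume_bound:
  assumes \<alpha>: "0 < \<alpha>" "\<alpha> \<le> vec_angle (orth_part e u) (orth_part e v)"
    and "e \<noteq> 0" and acute: "0 \<le> (e \<times> u) \<bullet> (e \<times> v)"
  shows "(sin \<alpha>)\<^sup>2 * ((norm (e \<times> u))\<^sup>2 * (norm (e \<times> v))\<^sup>2) \<le> (norm e)\<^sup>2 * (e \<bullet> (u \<times> v))\<^sup>2"
proof -
  let ?u = "orth_part e u" and ?v = "orth_part e v"
  note ip = inner_cross_orth_part[OF \<open>e \<noteq> 0\<close>]
  have nrm: "(norm (e \<times> w))\<^sup>2 = (norm e)\<^sup>2 * (norm (orth_part e w))\<^sup>2" for w
    using ip[of w w] by (simp add: power2_norm_eq_inner)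
  have "0 \<le> ?u \<bullet> ?v" using acute \<open>e \<noteq> 0\<close> by (simp add: ip zero_le_mult_iff)
  then have "(sin \<alpha>)\<^sup>2 * ((norm ?u)\<^sup>2 * (norm ?v)\<^sup>2) \<le> (norm ?u)\<^sup>2 * (norm ?v)\<^sup>2 - (?u \<bullet> ?v)\<^sup>2"
    by (rule sin_vec_angle_le[OF \<alpha>])
  \<comment> \<open>The factor \<open>(norm e) ^ 4\<close> turns the projections into the face
    normals \<open>e \<times> u\<close> and \<open>e \<times> v\<close>.\<close>
  then have "(norm e) ^ 4 * ((sin \<alpha>)\<^sup>2 * ((norm ?u)\<^sup>2 * (norm ?v)\<^sup>2)) \<le>
      (norm e) ^ 4 * ((norm ?u)\<^sup>2 * (norm ?v)\<^sup>2 - (?u \<bullet> ?v)\<^sup>2)"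
    by (intro mult_left_mono) auto
  also have "\<dots> = (norm (e \<times> u))\<^sup>2 * (norm (e \<times> v))\<^sup>2 - ((e \<times> u) \<bullet> (e \<times> v))\<^sup>2"
    unfolding nrm ip by (simp add: algebra_simps power2_eq_square power4_eq_xxxx)
  also have "\<dots> = (norm ((e \<times> u) \<times> (e \<times> v)))\<^sup>2" by (simp add: norm_cross)
  \<comment> \<open>Both normals are orthogonal to \<open>e\<close>, so their cross product is
    parallel to \<open>e\<close>.\<close>
  also have "(e \<times> u) \<times> (e \<times> v) = (e \<bullet> (u \<times> v)) *\<^sub>R e"
    unfolding cross_cross_det dot_cross_det by (simp add: det_3 vector_def)
  also have "(norm ((e \<bullet> (u \<times> v)) *\<^sub>R e))\<^sup>2 = (norm e)\<^sup>2 * (e \<bullet> (u \<times> v))\<^sup>2"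
    by (simp add: power_mult_distrib)
  finally show ?thesis unfolding nrm by (simp add: algebra_simps power2_eq_square power4_eq_xxxx)
qed

text \<open>The angle at \<open>p\<close> lies opposite a shortest side, hence is acute, and the
  triangle inequality makes \<open>r - p\<close> at least half as long as
  \<open>q - p\<close>.\<close>

lemma triangle_area_aux:
  fixes p q r :: "real^3"
  assumes \<alpha>: "0 < \<alpha>" "\<alpha> \<le> pi" "\<alpha> \<le> vec_angle (q - p) (r - p)"
    and long: "norm (r - q) \<le> norm (q - p)" and "norm (r - q) \<le> norm (r - p)"
  shows "(norm (q - p))\<^sup>2 * sin \<alpha> / 2 \<le> norm ((q - p) \<times> (r - p))"
proof -
  let ?u = "q - p" and ?v = "r - p"
  have "(norm (?v - ?u))\<^sup>2 \<le> (norm ?u)\<^sup>2" using long by (intro power_mono) auto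
  moreover have "(norm (?v - ?u))\<^sup>2 = (norm ?u)\<^sup>2 + (norm ?v)\<^sup>2 - 2 * (?u \<bullet> ?v)"
    unfolding power2_norm_eq_inner by (simp add: inner_diff_left inner_diff_right inner_commute)
  ultimately have "0 \<le> ?u \<bullet> ?v" using zero_le_power2[of "norm ?v"] by linarith
  then have "(sin \<alpha>)\<^sup>2 * ((norm ?u)\<^sup>2 * (norm ?v)\<^sup>2) \<le> (norm (?u \<times> ?v))\<^sup>2"
    using sin_vec_angle_le[OF \<alpha>(1,3)] by (simp add: norm_cross)
  then have "(sin \<alpha> * (norm ?u * norm ?v))\<^sup>2 \<le> (norm (?u \<times> ?v))\<^sup>2"
    by (simp add: power_mult_distrib)
  then have 1: "sin \<alpha> * (norm ?u * norm ?v) \<le> norm (?u \<times> ?v)" by (rule power2_le_imp_le) simp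
  have "norm ?u \<le> norm ?v + norm (r - q)"
    using norm_triangle_ineq4[of ?v "r - q"] by simp
  then have "norm ?u / 2 \<le> norm ?v" using assms(5) by linarith
  then have "sin \<alpha> * (norm ?u * (norm ?u / 2)) \<le> sin \<alpha> * (norm ?u * norm ?v)"
    using \<alpha> by (intro mult_left_mono) (auto simp: sin_ge_zero)
  with 1 show ?thesis by (simp add: power2_eq_square mult.commute)
qed

text \<open>One endpoint of the longest side \<open>pq\<close> lies opposite the shortest side;
  exchanging \<open>p\<close> and \<open>q\<close> only flips the sign of the cross product.\<close>

lemma triangle_area_ge:
  fixes p q r :: "real^3"
  assumes \<alpha>: "0 < \<alpha>" "\<alpha> \<le> pi" "\<alpha> \<le> vec_angle (q - p) (r - p)" "\<alpha> \<le> vec_angle (p - q) (r - q)"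
    and long: "norm (r - q) \<le> norm (q - p)" "norm (r - p) \<le> norm (q - p)"
  shows "(norm (q - p))\<^sup>2 * sin \<alpha> / 2 \<le> norm ((q - p) \<times> (r - p))"
proof (cases "norm (r - q) \<le> norm (r - p)")
  case True
  then show ?thesis using triangle_area_aux \<alpha> long by blast
next
  case False
  then have "(norm (p - q))\<^sup>2 * sin \<alpha> / 2 \<le> norm ((p - q) \<times> (r - q))"
    using \<alpha> long by (intro triangle_area_aux) (auto simp: norm_minus_commute)
  moreover have "(p - q) \<times> (r - q) = - ((q - p) \<times> (r - p))" by (simp add: cross3_simps)
  ultimately show ?thesis by (simp add: norm_minus_commute)
qed

text \<open>The area vector of the face \<open>abc\<close> is the sum of those of the other three faces, so one of
  the dihedral angles at \<open>abc\<close> is acute with a face of comparable area behind it; the lower bound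
  on that angle then bounds its sine as well.\<close>
lemma volume_ge_longest_edge:
  assumes \<alpha>: "0 < \<alpha>" "\<alpha> \<le> pi" and d: "distinct [a, b, c, d]" and c: "corners \<tau> = {a, b, c, d}"
    and ang: "\<And>\<theta>. \<theta> \<in> interior_angles \<tau> \<Longrightarrow> \<alpha> \<le> \<theta>"
    and long: "\<And>x y. x \<in> corners \<tau> \<Longrightarrow> y \<in> corners \<tau> \<Longrightarrow> norm (x - y) \<le> norm (b - a)"
  shows "(norm (b - a)) ^ 3 * (sin \<alpha>) ^ 3 / 12 \<le> \<bar>vol6 a b c d\<bar>"
proof -
  define l where "l = norm (b - a)"
  have l: "0 < l" using d by (auto simp: l_def)
  have s: "0 \<le> sin \<alpha>" using \<alpha> by (simp add: sin_ge_zero)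
  define N where "N = (b - a) \<times> (c - a)"
  have face: "\<alpha> \<le> vec_angle (y - x) (z - x)" if "distinct [x, y, z]" "{x, y, z} \<subseteq> corners \<tau>" for x y z
    using that by (intro ang) (unfold interior_angles_def face_angles_def, blast)
  have dihedral: "\<alpha> \<le> vec_angle (orth_part (y - x) (z - x)) (orth_part (y - x) (w - x))"
    if "distinct [x, y, z, w]" "{x, y, z, w} = corners \<tau>" for x y z w
    using that by (intro ang) (unfold interior_angles_def dihedral_angles_def, blast)
  have N: "l\<^sup>2 * sin \<alpha> / 2 \<le> norm N"
    unfolding N_def l_def
    by (rule triangle_area_ge[OF \<alpha>]; (rule face long)?) (use d c in auto)
  \<comment> \<open>Stated for an arbitrary edge of the face. The hypothesis \<open>ge\<close> gives
    an acute angle between the area vectors and, by Cauchy-Schwarz,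
    \<open>norm N / 3 \<le> norm ?M\<close>; squaring the 3 gives the 9.\<close>
  have edge: "(sin \<alpha>)\<^sup>2 * ((norm N)\<^sup>2 * (norm N)\<^sup>2 / 9) \<le> l\<^sup>2 * (vol6 a b c d)\<^sup>2"
    if xyz: "distinct [x, y, z, d]" "{x, y, z, d} = corners \<tau>"
      and Nx: "N = (y - x) \<times> (z - x)" and vx: "vol6 x y z d = vol6 a b c d"
      and ge: "(norm N)\<^sup>2 / 3 \<le> N \<bullet> ((y - x) \<times> (d - x))" for x y z
  proof -
    let ?M = "(y - x) \<times> (d - x)"
    have "(norm N)\<^sup>2 / 3 \<le> norm N * norm ?M"
      using ge norm_cauchy_schwarz[of N ?M] by linarith
    then have "norm N / 3 \<le> norm ?M"
      by (cases "norm N = 0") (auto simp: power2_eq_square)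
    then have "(norm N / 3)\<^sup>2 \<le> (norm ?M)\<^sup>2" by (intro power_mono) auto
    then have "(sin \<alpha>)\<^sup>2 * ((norm N)\<^sup>2 * (norm N)\<^sup>2 / 9) \<le> (sin \<alpha>)\<^sup>2 * ((norm N)\<^sup>2 * (norm ?M)\<^sup>2)"
      using mult_left_mono[of "(norm N / 3)\<^sup>2" "(norm ?M)\<^sup>2" "(norm N)\<^sup>2"]
      by (intro mult_left_mono) (auto simp: power_divide)
    also have "\<dots> \<le> (norm (y - x))\<^sup>2 * (vol6 x y z d)\<^sup>2"
      unfolding Nx vol6_def
    proof (rule dihedral_volume_bound[OF \<alpha>(1) dihedral[OF xyz]])
      show "y - x \<noteq> 0" using xyz by auto
      show "0 \<le> (y - x) \<times> (z - x) \<bullet> ((y - x) \<times> (d - x))"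
        using ge zero_le_power2[of "norm N"] unfolding Nx[symmetric] by linarith
    qed
    also have "\<dots> \<le> l\<^sup>2 * (vol6 x y z d)\<^sup>2"
      using long[of y x] xyz(2) by (intro mult_right_mono power_mono) (auto simp: l_def)
    finally show ?thesis unfolding vx .
  qed
  have sum: "N = (b - a) \<times> (d - a) + (c - b) \<times> (d - b) + (a - c) \<times> (d - c)"
    unfolding N_def by (simp add: cross3_simps)
  \<comment> \<open>Rotating the base \<open>a, b, c\<close> cyclically fixes its area vector and
    the signed volume, so \<open>edge\<close> applies to all three edges.\<close>
  have rot: "N = (c - b) \<times> (a - b)" "N = (a - c) \<times> (b - c)"
    "vol6 b c a d = vol6 a b c d" "vol6 c a b d = vol6 a b c d"
    unfolding N_def vol6_def by (simp_all add: cross3_simps)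
  \<comment> \<open>One of the three summands is at least a third of the total.\<close>
  have "N \<bullet> N = N \<bullet> ((b - a) \<times> (d - a)) + N \<bullet> ((c - b) \<times> (d - b)) + N \<bullet> ((a - c) \<times> (d - c))"
    by (subst (2) sum) (simp add: inner_add_right)
  then consider "(norm N)\<^sup>2 / 3 \<le> N \<bullet> ((b - a) \<times> (d - a))"
    | "(norm N)\<^sup>2 / 3 \<le> N \<bullet> ((c - b) \<times> (d - b))" | "(norm N)\<^sup>2 / 3 \<le> N \<bullet> ((a - c) \<times> (d - c))"
    unfolding power2_norm_eq_inner by linarith
  then have sq: "(sin \<alpha>)\<^sup>2 * ((norm N)\<^sup>2 * (norm N)\<^sup>2 / 9) \<le> l\<^sup>2 * (vol6 a b c d)\<^sup>2"
  proof cases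
    case 1 then show ?thesis by (intro edge[of a b c]) (use d c N_def in auto)
  next
    case 2 then show ?thesis by (intro edge[of b c a] rot) (use d c in auto)
  next
    case 3 then show ?thesis by (intro edge[of c a b] rot) (use d c in auto)
  qed
  have "(sin \<alpha> * (norm N)\<^sup>2 / 3)\<^sup>2 \<le> (l * \<bar>vol6 a b c d\<bar>)\<^sup>2"
  proof -
    have "(sin \<alpha> * (norm N)\<^sup>2 / 3)\<^sup>2 = (sin \<alpha>)\<^sup>2 * ((norm N)\<^sup>2 * (norm N)\<^sup>2 / 9)"
      by (simp add: power2_eq_square)
    then show ?thesis using sq by (simp add: power_mult_distrib)
  qed
  then have "sin \<alpha> * (norm N)\<^sup>2 / 3 \<le> l * \<bar>vol6 a b c d\<bar>"
    by (rule power2_le_imp_le) (use l in simp)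
  \<comment> \<open>Inserting the area bound squares its 1/2, and 3 * 4 = 12 is the constant of the
    statement.\<close>
  moreover have "sin \<alpha> * (l\<^sup>2 * sin \<alpha> / 2)\<^sup>2 / 3 \<le> sin \<alpha> * (norm N)\<^sup>2 / 3"
  proof -
    have "0 \<le> l\<^sup>2 * sin \<alpha> / 2" using s by simp
    with N have "(l\<^sup>2 * sin \<alpha> / 2)\<^sup>2 \<le> (norm N)\<^sup>2" by (rule power_mono)
    then have "sin \<alpha> * (l\<^sup>2 * sin \<alpha> / 2)\<^sup>2 \<le> sin \<alpha> * (norm N)\<^sup>2" using s by (rule mult_left_mono)
    then show ?thesis by (rule divide_right_mono) simp
  qed
  ultimately have "sin \<alpha> * (l\<^sup>2 * sin \<alpha> / 2)\<^sup>2 / 3 \<le> l * \<bar>vol6 a b c d\<bar>" by linarith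
  moreover have "sin \<alpha> * (l\<^sup>2 * sin \<alpha> / 2)\<^sup>2 / 3 = l * (l ^ 3 * (sin \<alpha>) ^ 3 / 12)"
    by (simp add: power2_eq_square power3_eq_cube)
  ultimately have "l * (l ^ 3 * (sin \<alpha>) ^ 3 / 12) \<le> l * \<bar>vol6 a b c d\<bar>" by simp
  then show ?thesis using l by (simp only: mult_le_cancel_left_pos l_def[symmetric])
qed

text \<open>The radius is the length of a longest edge: it bounds the distance between any two
  corners, and balls are convex.\<close>

lemma shape_regular_ball_bound:
  assumes "shape_regular \<S>" and simplex: "\<And>\<tau>. \<tau> \<in> \<S> \<Longrightarrow> 3 simplex \<tau>"
  shows "\<exists>K>0. \<forall>\<tau>\<in>\<S>. \<exists>r\<ge>0. r ^ 3 \<le> K * measure lborel \<tau> \<and> (\<forall>v\<in>corners \<tau>. \<tau> \<subseteq> cball v r)"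
proof -
  obtain \<alpha>0 where "0 < \<alpha>0" and ang0: "\<And>\<tau> \<theta>. \<tau> \<in> \<S> \<Longrightarrow> \<theta> \<in> interior_angles \<tau> \<Longrightarrow> \<alpha>0 \<le> \<theta>"
    using assms(1) unfolding shape_regular_def by blast
  \<comment> \<open>Capping at \<open>pi / 2\<close> keeps the sine positive, and lowering the bound
    on the angles keeps it valid.\<close>
  define \<alpha> where "\<alpha> = min \<alpha>0 (pi / 2)"
  have \<alpha>: "0 < \<alpha>" "\<alpha> \<le> pi" and s: "0 < sin \<alpha>"
    using \<open>0 < \<alpha>0\<close> pi_gt_zero unfolding \<alpha>_def by (auto simp: min_def intro!: sin_gt_zero) 
  \<comment> \<open>72 = 12 * 6, from the constant of \<open>volume_ge_longest_edge\<close> and the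
    factor 6 in \<open>vol6\<close>.\<close>
  define K where "K = 72 / (sin \<alpha>) ^ 3"
  have K: "0 < K" using s by (simp add: K_def)
  have "\<exists>r\<ge>0. r ^ 3 \<le> K * measure lborel \<tau> \<and> (\<forall>v\<in>corners \<tau>. \<tau> \<subseteq> cball v r)" if "\<tau> \<in> \<S>" for \<tau>
  proof -
    obtain a0 b0 c0 d0 where c0: "distinct [a0, b0, c0, d0]" "corners \<tau> = {a0, b0, c0, d0}"
      "\<tau> = convex hull {a0, b0, c0, d0}"
      using simplex_cornersE[OF simplex[OF \<open>\<tau> \<in> \<S>\<close>]] by metis
    have hull: "\<tau> = convex hull (corners \<tau>)" using c0 by simp
    \<comment> \<open>A maximizing pair of corners gives a longest edge; its ends differ because
      \<open>a0\<close> and \<open>b0\<close> already have positive distance.\<close>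
    let ?P = "Sigma (corners \<tau>) (\<lambda>_. corners \<tau>)"
    let ?g = "\<lambda>(x, y). norm (x - y)"
    have fin: "finite ?P" and "?P \<noteq> {}" using c0 by auto
    then have "Max (?g ` ?P) \<in> ?g ` ?P" by (intro Max_in) auto
    then obtain b a where ba: "b \<in> corners \<tau>" "a \<in> corners \<tau>" and max: "norm (b - a) = Max (?g ` ?P)"
      by auto
    have long: "norm (x - y) \<le> norm (b - a)" if "x \<in> corners \<tau>" "y \<in> corners \<tau>" for x y
      unfolding max using fin that by (intro Max_ge) auto
    have "a \<noteq> b" using long[of a0 b0] c0 by auto
    then have "card (corners \<tau> - {a, b}) = 2" using ba c0 by (subst card_Diff_subset) auto
    then obtain c d where cd: "corners \<tau> - {a, b} = {c, d}" "c \<noteq> d" by (auto simp: card_2_iff)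
    then have corn: "corners \<tau> = {a, b, c, d}" and dist: "distinct [a, b, c, d]"
      using ba \<open>a \<noteq> b\<close> by auto
    have "(norm (b - a)) ^ 3 * (sin \<alpha>) ^ 3 / 12 \<le> \<bar>vol6 a b c d\<bar>"
    proof (rule volume_ge_longest_edge[OF \<alpha> dist corn])
      show "\<alpha> \<le> \<theta>" if "\<theta> \<in> interior_angles \<tau>" for \<theta>
        using ang0[OF \<open>\<tau> \<in> \<S>\<close> that] by (simp add: \<alpha>_def)
    qed (use long in auto)
    then have "(norm (b - a)) ^ 3 \<le> K * measure lborel \<tau>"
      using s content_tetrahedron[OF dist] hull corn by (simp add: K_def field_simps)
    moreover have "\<tau> \<subseteq> cball v (norm (b - a))" if "v \<in> corners \<tau>" for v
    proof -
      have "corners \<tau> \<subseteq> cball v (norm (b - a))" using long[OF that] by (auto simp: dist_norm)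
      then show ?thesis by (subst hull) (rule hull_minimal, auto)
    qed
    ultimately show ?thesis by (intro exI[of _ "norm (b - a)"]) auto
  qed
  with K show ?thesis by blast
qed

subsection \<open>The \<open>L2\<close> norm of a finite element function\<close>

text \<open>Serves both integrals in use: the Lebesgue integral of \<open>L2_norm\<close> and the
  gauge integral that is split over the mesh.\<close>

lemma continuous_on_compact_integrable:
  fixes f :: "'a::euclidean_space \<Rightarrow> real"
  assumes "compact S" "continuous_on S f"
  shows "set_integrable lborel S f" "f integrable_on S"
proof -
  show "set_integrable lborel S f"
    unfolding set_integrable_def using borel_integrable_compact[OF assms] .
  then show "f integrable_on S" by (rule set_borel_integral_eq_integral(1))
qed

lemma measure_lebesgue_compact:
  fixes S :: "'a::euclidean_space set"
  assumes "compact S"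
  shows "measure lebesgue S = measure lborel S"
  using borel_compact[OF assms] by (intro measure_completion) simp

lemma integral_const_compact:
  fixes S :: "'a::euclidean_space set"
  assumes "compact S"
  shows "integral S (\<lambda>_. c :: real) = c * measure lborel S"
proof -
  have "measure lebesgue S = integral S (\<lambda>_. 1)"
    using assms by (intro lmeasure_integral lmeasurable_compact)
  moreover have "integral S (\<lambda>_. c * 1) = c * integral S (\<lambda>_. 1)" by (rule integral_mult_right)
  ultimately show ?thesis using measure_lebesgue_compact[OF assms] by simp
qed

text \<open>With \<open>v\<close> a corner where \<open>\<bar>f\<bar>\<close> is largest,
  \<open>(f v)\<^sup>2\<close> bounds the integrand and is itself one of the summands. From below,
  only the quarter-size copy of \<tau> at \<open>v\<close> is kept: 1024 = 4 * 4 * 64 collects the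
  four corners, the halved value squared and the volume ratio.\<close>

lemma integral_affine_square_bounds:
  assumes \<tau>: "3 simplex \<tau>" and aff: "\<forall>x\<in>\<tau>. f x = g \<bullet> x + h"
  shows "measure lborel \<tau> * (\<Sum>v\<in>corners \<tau>. (f v)\<^sup>2) / 1024 \<le> integral \<tau> (\<lambda>y. (f y)\<^sup>2)"
    and "integral \<tau> (\<lambda>y. (f y)\<^sup>2) \<le> measure lborel \<tau> * (\<Sum>v\<in>corners \<tau>. (f v)\<^sup>2)"
proof -
  obtain a b c d where abcd: "distinct [a, b, c, d]" "corners \<tau> = {a, b, c, d}"
    "\<tau> = convex hull {a, b, c, d}" using simplex_cornersE[OF \<tau>] by metis
  have hull: "\<tau> = convex hull (corners \<tau>)" and fin: "finite (corners \<tau>)" and card: "card (corners \<tau>) = 4"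
    using abcd by auto
  let ?A = "(\<lambda>v. \<bar>f v\<bar>) ` corners \<tau>"
  have "Max ?A \<in> ?A" using fin abcd by (intro Max_in) auto
  then obtain v where v: "v \<in> corners \<tau>" and "Max ?A = \<bar>f v\<bar>" by auto
  then have max: "\<bar>f w\<bar> \<le> \<bar>f v\<bar>" if "w \<in> corners \<tau>" for w
    using Max_ge[of ?A "\<bar>f w\<bar>"] that fin by auto
  note quarter = affine_abs_le_vertex[of "corners \<tau>" f g h v, folded hull, OF aff v max]
  have comp: "compact \<tau>" by (rule compact_simplex[OF \<tau>])
  have cont: "continuous_on \<tau> (\<lambda>y. (f y)\<^sup>2)"
  proof -
    have "continuous_on \<tau> (\<lambda>y. (g \<bullet> y + h)\<^sup>2)" by (intro continuous_intros)
    then show ?thesis by (rule continuous_on_eq) (use aff in auto)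
  qed
  have int: "(\<lambda>y. (f y)\<^sup>2) integrable_on \<tau>"
    using comp cont by (rule continuous_on_compact_integrable)
  have const: "(\<lambda>_. c :: real) integrable_on S" if "compact S" for c and S :: "(real^3) set"
    using that by (intro continuous_on_compact_integrable continuous_intros)
  have "integral \<tau> (\<lambda>y. (f y)\<^sup>2) \<le> integral \<tau> (\<lambda>_. (f v)\<^sup>2)"
    using quarter(1) by (intro integral_le int const comp) (simp add: abs_le_square_iff)
  also have "\<dots> = measure lborel \<tau> * (f v)\<^sup>2"
    by (simp add: integral_const_compact comp)
  also have "\<dots> \<le> measure lborel \<tau> * (\<Sum>v\<in>corners \<tau>. (f v)\<^sup>2)"
    using v fin by (intro mult_left_mono member_le_sum) auto
  finally show "integral \<tau> (\<lambda>y. (f y)\<^sup>2) \<le> measure lborel \<tau> * (\<Sum>v\<in>corners \<tau>. (f v)\<^sup>2)" .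
  define Q where "Q = (\<lambda>x. (1/4) *\<^sub>R x + (3/4) *\<^sub>R v) ` \<tau>"
  have Q\<tau>: "Q \<subseteq> \<tau>" and Qf: "\<And>y. y \<in> Q \<Longrightarrow> \<bar>f v\<bar> / 2 \<le> \<bar>f y\<bar>"
    using quarter(2,3) unfolding Q_def by auto
  have Qcomp: "compact Q" unfolding Q_def by (intro compact_continuous_image continuous_intros comp)
  have "measure lebesgue Q = \<bar>1/4\<bar> ^ DIM(real^3) * measure lebesgue \<tau>"
    unfolding Q_def by (rule measure_lebesgue_affine)
  then have mQ: "measure lborel Q = measure lborel \<tau> / 64"
    by (simp add: measure_lebesgue_compact comp Qcomp power3_eq_cube)
  have "(\<Sum>v\<in>corners \<tau>. (f v)\<^sup>2) \<le> 4 * (f v)\<^sup>2"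
    using sum_bounded_above[of "corners \<tau>" "\<lambda>w. (f w)\<^sup>2" "(f v)\<^sup>2"] max card
    by (auto simp: abs_le_square_iff)
  then have "measure lborel \<tau> * (\<Sum>v\<in>corners \<tau>. (f v)\<^sup>2) \<le> measure lborel \<tau> * (4 * (f v)\<^sup>2)"
    by (rule mult_left_mono) simp
  then have "measure lborel \<tau> * (\<Sum>v\<in>corners \<tau>. (f v)\<^sup>2) / 1024 \<le> (\<bar>f v\<bar> / 2)\<^sup>2 * measure lborel Q"
    by (simp add: mQ power_divide mult_ac)
  also have "\<dots> = integral Q (\<lambda>_. (\<bar>f v\<bar> / 2)\<^sup>2)" by (simp add: integral_const_compact Qcomp)
  also have "\<dots> \<le> integral Q (\<lambda>y. (f y)\<^sup>2)"
  proof (intro integral_le const Qcomp)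
    show "(\<lambda>y. (f y)\<^sup>2) integrable_on Q"
      using Qcomp continuous_on_subset[OF cont Q\<tau>] by (rule continuous_on_compact_integrable)
    show "(\<bar>f v\<bar> / 2)\<^sup>2 \<le> (f y)\<^sup>2" if "y \<in> Q" for y
      using power_mono[OF Qf[OF that], of 2] by simp
  qed
  also have "\<dots> \<le> integral \<tau> (\<lambda>y. (f y)\<^sup>2)"
    using Q\<tau> Qcomp comp cont continuous_on_subset[OF cont Q\<tau>]
    by (intro integral_subset_le continuous_on_compact_integrable(2)) auto
  finally show "measure lborel \<tau> * (\<Sum>v\<in>corners \<tau>. (f v)\<^sup>2) / 1024 \<le> integral \<tau> (\<lambda>y. (f y)\<^sup>2)" .
qed

section \<open>Splitting the norm over the mesh\<close>

lemma tetrahedra_overlap_negligible: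
  assumes "tetrahedral_mesh D \<S>"
  shows "pairwise (\<lambda>\<sigma> \<tau>. negligible (\<sigma> \<inter> \<tau>)) \<S>"
proof (rule pairwiseI)
  fix \<sigma> \<tau> assume "\<sigma> \<in> \<S>" "\<tau> \<in> \<S>" "\<sigma> \<noteq> \<tau>"
  then have "interior (\<sigma> \<inter> \<tau>) = {}" "3 simplex \<sigma>" "3 simplex \<tau>"
    using assms unfolding tetrahedral_mesh_def by auto
  moreover from this have "convex (\<sigma> \<inter> \<tau>)" by (intro convex_Int convex_simplex)
  ultimately show "negligible (\<sigma> \<inter> \<tau>)" by (simp add: negligible_convex_interior)
qed

text \<open>Each boundary piece is a convex set of dimension 2, hence without interior points. This
  allows integrals over \<Omega> and over its closure to be exchanged.\<close>

lemma polyhedral_frontier_negligible: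
  assumes "polyhedral_domain \<Omega>"
  shows "negligible (frontier \<Omega>)"
proof -
  obtain P where P: "finite P" "\<forall>F\<in>P. polytope F \<and> aff_dim F = 2" "frontier \<Omega> = \<Union>P"
    using assms unfolding polyhedral_domain_def by blast
  have "negligible F" if "F \<in> P" for F
  proof -
    have "convex F" "aff_dim F = 2" using P that polytope_imp_convex by auto
    moreover have "interior F = {}"
      using aff_dim_nonempty_interior[of F] \<open>aff_dim F = 2\<close> by fastforce
    ultimately show ?thesis by (simp add: negligible_convex_interior)
  qed
  then show ?thesis using P by (simp add: negligible_Union)
qed

text \<open>The mesh covers the closure, which adds only the negligible frontier to \<Omega>, and
  distinct tetrahedra overlap in null sets, so the integral is additive over the mesh.\<close>

lemma L2_norm_square_eq_sum:
  assumes \<Omega>: "polyhedral_domain \<Omega>" and mesh: "tetrahedral_mesh (closure \<Omega>) \<S>"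
    and cont: "continuous_on (closure \<Omega>) f"
  shows "(L2_norm \<Omega> f)\<^sup>2 = (\<Sum>\<tau>\<in>\<S>. integral \<tau> (\<lambda>y. (f y)\<^sup>2))"
proof -
  have op: "open \<Omega>" and bd: "bounded \<Omega>" using \<Omega> by (auto simp: polyhedral_domain_def)
  let ?q = "\<lambda>y. (f y)\<^sup>2"
  have comp: "compact (closure \<Omega>)" using bd by (simp add: compact_closure)
  have q: "continuous_on (closure \<Omega>) ?q" using cont by (intro continuous_intros)
  have "set_integrable lborel (closure \<Omega>) ?q" using comp q by (rule continuous_on_compact_integrable)
  then have "set_integrable lborel \<Omega> ?q"
    by (rule set_integrable_subset) (use op closure_subset in auto)
  then have 1: "(LINT y:\<Omega>|lborel. ?q y) = integral \<Omega> ?q" by (rule set_borel_integral_eq_integral(2))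
  \<comment> \<open>Nonnegativity lets the square cancel the square root of \<open>L2_norm\<close>
    at the end.\<close>
  have "0 \<le> integral \<Omega> ?q" by (rule integral_nonneg) 
    (use \<open>set_integrable lborel \<Omega> ?q\<close> set_borel_integral_eq_integral(1) in auto)
  have "integral \<Omega> ?q = integral (closure \<Omega>) ?q"
  proof (rule integral_spike_set)
    have "{x \<in> closure \<Omega> - \<Omega>. ?q x \<noteq> 0} \<subseteq> frontier \<Omega>" 
      using op by (auto simp: frontier_def interior_open)
    then show "negligible {x \<in> closure \<Omega> - \<Omega>. ?q x \<noteq> 0}"
      using polyhedral_frontier_negligible[OF \<Omega>] negligible_subset by blast
    have "{x \<in> \<Omega> - closure \<Omega>. ?q x \<noteq> 0} = {}" using closure_subset by auto
    then show "negligible {x \<in> \<Omega> - closure \<Omega>. ?q x \<noteq> 0}" by (metis negligible_empty)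
  qed
  moreover have "(?q has_integral (\<Sum>\<tau>\<in>\<S>. integral \<tau> ?q)) (\<Union>\<S>)"
  proof (rule has_integral_Union)
    show "finite \<S>" using mesh by (simp add: tetrahedral_mesh_def)
    show "pairwise (\<lambda>S S'. negligible (S \<inter> S')) \<S>" by (rule tetrahedra_overlap_negligible[OF mesh])
    fix \<tau> assume "\<tau> \<in> \<S>"
    then have "\<tau> \<subseteq> closure \<Omega>" "compact \<tau>"
      using mesh by (auto simp: tetrahedral_mesh_def intro: compact_simplex)
    then have "?q integrable_on \<tau>"
      using continuous_on_subset[OF q] by (intro continuous_on_compact_integrable)
    then show "(?q has_integral integral \<tau> ?q) \<tau>" by (rule integrable_integral)
  qed
  ultimately have "integral \<Omega> ?q = (\<Sum>\<tau>\<in>\<S>. integral \<tau> ?q)"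
    using mesh by (auto simp: tetrahedral_mesh_def dest: integral_unique)
  then show ?thesis
    unfolding L2_norm_def 1 using \<open>0 \<le> integral \<Omega> ?q\<close> by (simp only: real_sqrt_pow2)
qed

text \<open>Taken over the tetrahedra with \<open>v\<close> as a corner, the form that the exchange
  of sums produces; for a node of a conforming mesh, \<open>conforming_corner\<close> identifies
  them with the tetrahedra containing \<open>v\<close>.\<close>

definition star_volume :: "(real^3) set set \<Rightarrow> real^3 \<Rightarrow> real" where
  "star_volume \<S> v = (\<Sum>\<tau>\<in>{\<tau> \<in> \<S>. v \<in> corners \<tau>}. measure lborel \<tau>)"

lemma finite_nodes:
  assumes "tetrahedral_mesh D \<S>"
  shows "finite (nodes \<S>)"
proof -
  have "finite (corners \<tau>)" if "\<tau> \<in> \<S>" for \<tau>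
  proof -
    have "3 simplex \<tau>" using that assms by (simp add: tetrahedral_mesh_def)
    then show ?thesis by (rule simplex_cornersE) simp
  qed
  then show ?thesis using assms by (auto simp: nodes_def tetrahedral_mesh_def)
qed

text \<open>Summing \<open>integral_affine_square_bounds\<close> over the mesh counts
  \<open>(f v)\<^sup>2\<close> once for each tetrahedron at \<open>v\<close>, weighted by its
  volume; exchanging the sums collects the weights into the star volume.\<close>

lemma L2_norm_fe_bounds:
  assumes \<Omega>: "polyhedral_domain \<Omega>" and mesh: "tetrahedral_mesh (closure \<Omega>) \<S>"
    and f: "f \<in> fe_space \<Omega> \<S>"
  shows "(\<Sum>v\<in>nodes \<S>. (f v)\<^sup>2 * star_volume \<S> v) / 1024 \<le> (L2_norm \<Omega> f)\<^sup>2"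
    and "(L2_norm \<Omega> f)\<^sup>2 \<le> (\<Sum>v\<in>nodes \<S>. (f v)\<^sup>2 * star_volume \<S> v)"
proof -
  have cont: "continuous_on (closure \<Omega>) f" and aff: "\<And>\<tau>. \<tau> \<in> \<S> \<Longrightarrow> \<exists>a b. \<forall>x\<in>\<tau>. f x = a \<bullet> x + b"
    using f by (auto simp: fe_space_def)
  have simplex: "\<And>\<tau>. \<tau> \<in> \<S> \<Longrightarrow> 3 simplex \<tau>" and fin: "finite \<S>"
    using mesh by (auto simp: tetrahedral_mesh_def)
  have finN: "finite (nodes \<S>)" by (rule finite_nodes[OF mesh])
  have corners: "corners \<tau> = {v. v \<in> nodes \<S> \<and> v \<in> corners \<tau>}" if "\<tau> \<in> \<S>" for \<tau>
    using that by (auto simp: nodes_def)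
  have "(\<Sum>\<tau>\<in>\<S>. measure lborel \<tau> * (\<Sum>v\<in>corners \<tau>. (f v)\<^sup>2)) =
      (\<Sum>\<tau>\<in>\<S>. \<Sum>v\<in>{v. v \<in> nodes \<S> \<and> v \<in> corners \<tau>}. measure lborel \<tau> * (f v)\<^sup>2)"
    using corners by (intro sum.cong refl) (simp add: sum_distrib_left)
  also have "\<dots> = (\<Sum>v\<in>nodes \<S>. \<Sum>\<tau>\<in>{\<tau>. \<tau> \<in> \<S> \<and> v \<in> corners \<tau>}. measure lborel \<tau> * (f v)\<^sup>2)"
    using fin finN by (rule sum.swap_restrict)
  also have "\<dots> = (\<Sum>v\<in>nodes \<S>. (f v)\<^sup>2 * star_volume \<S> v)"
    by (simp add: star_volume_def sum_distrib_left mult.commute)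
  finally have swap: "(\<Sum>\<tau>\<in>\<S>. measure lborel \<tau> * (\<Sum>v\<in>corners \<tau>. (f v)\<^sup>2)) = \<dots>" .
  note L2 = L2_norm_square_eq_sum[OF \<Omega> mesh cont]
  show "(\<Sum>v\<in>nodes \<S>. (f v)\<^sup>2 * star_volume \<S> v) / 1024 \<le> (L2_norm \<Omega> f)\<^sup>2"
    unfolding L2 swap[symmetric] sum_divide_distrib
    by (intro sum_mono) (metis integral_affine_square_bounds(1) simplex aff)
  show "(L2_norm \<Omega> f)\<^sup>2 \<le> (\<Sum>v\<in>nodes \<S>. (f v)\<^sup>2 * star_volume \<S> v)"
    unfolding L2 swap[symmetric]
    by (intro sum_mono) (metis integral_affine_square_bounds(2) simplex aff)
qed

subsection \<open>Volume and level\<close>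

lemma BEK_sequenceD:
  assumes "BEK_sequence \<Omega> \<T>"
  shows "tetrahedral_mesh (closure \<Omega>) (\<T> j)" "finite (\<T> j)" "conforming (\<T> j)"
    "\<tau> \<in> \<T> j \<Longrightarrow> 3 simplex \<tau>"
    "\<sigma> \<in> \<T> j \<Longrightarrow> \<tau> \<in> \<T> j \<Longrightarrow> \<sigma> \<noteq> \<tau> \<Longrightarrow> interior \<sigma> \<inter> interior \<tau> = {}"
proof -
  show mesh: "tetrahedral_mesh (closure \<Omega>) (\<T> j)" and "conforming (\<T> j)"
    using assms by (simp_all add: BEK_sequence_def)
  from mesh show "finite (\<T> j)" "\<tau> \<in> \<T> j \<Longrightarrow> 3 simplex \<tau>"
    "\<sigma> \<in> \<T> j \<Longrightarrow> \<tau> \<in> \<T> j \<Longrightarrow> \<sigma> \<noteq> \<tau> \<Longrightarrow> interior \<sigma> \<inter> interior \<tau> = {}"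
    by (simp_all add: tetrahedral_mesh_def)
qed

text \<open>If the father survived, \<open>\<T> (Suc m)\<close> would contain it together with its
  proper subset \<tau>, whose nonempty interior would lie in both. So the father was
  refined.\<close>

lemma BEK_father:
  assumes BEK: "BEK_sequence \<Omega> \<T>" and \<tau>: "\<tau> \<in> \<T> (Suc m)" "\<tau> \<notin> \<T> m"
  obtains \<rho> where "\<rho> \<in> \<T> m" "\<rho> \<notin> \<T> (Suc m)" "\<tau> \<in> sons \<T> m \<rho>"
    "corners \<tau> \<subseteq> corners \<rho> \<union> edge_midpoints \<rho>"
    "regular_refinement \<rho> (sons \<T> m \<rho>) \<or> irregular_refinement \<rho> (sons \<T> m \<rho>)"
proof -
  from BEK have "nested \<T>" "refinement_step \<T> m" by (simp_all add: BEK_sequence_def)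
  then obtain \<rho> where \<rho>: "\<rho> \<in> \<T> m" "\<tau> \<subseteq> \<rho>" and cs: "corners \<tau> \<subseteq> corners \<rho> \<union> edge_midpoints \<rho>"
    using \<tau>(1) unfolding nested_def by metis
  have "\<rho> \<notin> \<T> (Suc m)"
  proof
    assume "\<rho> \<in> \<T> (Suc m)"
    moreover have "\<rho> \<noteq> \<tau>" using \<rho>(1) \<tau>(2) by blast
    ultimately have "interior \<rho> \<inter> interior \<tau> = {}" using BEK_sequenceD(5)[OF BEK] \<tau>(1) by blast
    moreover have "interior \<tau> \<subseteq> interior \<rho>" using \<rho>(2) by (rule interior_mono)
    moreover have "interior \<tau> \<noteq> {}" using simplex_content_pos(1) BEK_sequenceD(4)[OF BEK \<tau>(1)] by blast
    ultimately show False by blast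
  qed
  moreover have "\<tau> \<in> sons \<T> m \<rho>" using \<rho> \<tau>(1) by (simp add: sons_def)
  ultimately show ?thesis
    using that[of \<rho>] \<rho> cs \<open>refinement_step \<T> m\<close> unfolding refinement_step_def by blast
qed

text \<open>A refined tetrahedron of level \<open>m\<close> is not irregular, and neither is any of its ancestors,
  so all of the \<open>m\<close> refinements leading to it are regular and divide the volume by 8.\<close>
lemma refined_content:
  assumes BEK: "BEK_sequence \<Omega> \<T>" and v: "\<And>\<tau>. \<tau> \<in> \<T> 0 \<Longrightarrow> v \<le> measure lborel \<tau> \<and> measure lborel \<tau> \<le> V"
    and \<tau>: "\<tau> \<in> \<T> m" "\<tau> \<notin> \<T> (Suc m)"
  shows "v / 8 ^ m \<le> measure lborel \<tau> \<and> measure lborel \<tau> \<le> V / 8 ^ m"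
  using \<tau>
proof (induction m arbitrary: \<tau>)
  case 0
  then show ?case using v by simp
next
  case (Suc m)
  have newest: "only_newest_refined \<T>" and irr: "irregular_not_refined \<T>"
    using BEK by (simp_all add: BEK_sequence_def)
  \<comment> \<open>Being refined, \<tau> has level exactly \<open>Suc m\<close>, so it was created
    in the preceding step and has a refined father.\<close>
  have "level \<T> \<tau> = Suc m" using newest Suc.prems unfolding only_newest_refined_def by blast
  then have "\<tau> \<notin> \<T> m" unfolding level_def using not_less_Least[of m "\<lambda>j. \<tau> \<in> \<T> j"] by auto
  then obtain \<rho> where \<rho>: "\<rho> \<in> \<T> m" "\<rho> \<notin> \<T> (Suc m)" "\<tau> \<in> sons \<T> m \<rho>"
    "regular_refinement \<rho> (sons \<T> m \<rho>) \<or> irregular_refinement \<rho> (sons \<T> m \<rho>)"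
    using BEK_father[OF BEK Suc.prems(1)] by metis
  \<comment> \<open>Otherwise \<tau> would be irregular and would be kept, contrary to its being
    refined.\<close>
  have "\<not> irregular_refinement \<rho> (sons \<T> m \<rho>)"
    using irr Suc.prems \<rho> unfolding irregular_not_refined_def irregular_tetrahedron_def by blast
  then have "measure lborel \<tau> = measure lborel \<rho> / 8"
    using content_regular_son \<rho> BEK_sequenceD(4)[OF BEK] Suc.prems(1) by blast
  with Suc.IH[OF \<rho>(1,2)] show ?case by simp
qed

text \<open>The last refinement may be irregular, so the volume is only known to lie between an
  eighth of the father's and all of it. The father is one level lower, hence the lower bound loses
  nothing and the upper bound loses a factor 8.\<close>

lemma content_level:
  assumes BEK: "BEK_sequence \<Omega> \<T>" and v: "\<And>\<tau>. \<tau> \<in> \<T> 0 \<Longrightarrow> v \<le> measure lborel \<tau> \<and> measure lborel \<tau> \<le> V"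
    and "0 \<le> v" and \<tau>: "\<tau> \<in> \<T> j"
  shows "v / 8 ^ level \<T> \<tau> \<le> measure lborel \<tau>" "measure lborel \<tau> \<le> 8 * V / 8 ^ level \<T> \<tau>"
proof -
  define L where "L = level \<T> \<tau>"
  have in_L: "\<tau> \<in> \<T> L" unfolding L_def level_def using \<tau> by (rule LeastI)
  have not_before: "\<tau> \<notin> \<T> k" if "k < L" for k
    using that not_less_Least[of k "\<lambda>j. \<tau> \<in> \<T> j"] by (simp add: L_def level_def)
  have "v / 8 ^ L \<le> measure lborel \<tau> \<and> measure lborel \<tau> \<le> 8 * V / 8 ^ L"
  proof (cases L)
    case 0
    then have "v \<le> measure lborel \<tau>" "measure lborel \<tau> \<le> V" using v in_L by auto
    moreover have "0 \<le> V" using calculation \<open>0 \<le> v\<close> by linarith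
    ultimately show ?thesis using 0 by simp
  next
    case (Suc m)
    then have "\<tau> \<in> \<T> (Suc m)" "\<tau> \<notin> \<T> m" using in_L not_before by auto
    then obtain \<rho> where \<rho>: "\<rho> \<in> \<T> m" "\<rho> \<notin> \<T> (Suc m)" "\<tau> \<in> sons \<T> m \<rho>"
      "corners \<tau> \<subseteq> corners \<rho> \<union> edge_midpoints \<rho>"
      using BEK_father[OF BEK] by metis
    have simp\<rho>: "3 simplex \<rho>" and simp\<tau>: "3 simplex \<tau>"
      using BEK_sequenceD(4)[OF BEK] \<rho>(1) \<tau> by auto
    have "measure lborel \<rho> / 8 \<le> measure lborel \<tau>"
      using content_son_ge[OF simp\<rho> simp\<tau> \<rho>(4)] .
    moreover have "measure lborel \<tau> \<le> measure lborel \<rho>"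
    proof -
      have "measure lebesgue \<tau> \<le> measure lebesgue \<rho>"
        using \<rho>(3) compact_simplex[OF simp\<rho>] compact_simplex[OF simp\<tau>]
        by (intro measure_mono_fmeasurable) (auto simp: sons_def lmeasurable_compact fmeasurableD)
      then show ?thesis
        using measure_lebesgue_compact compact_simplex[OF simp\<rho>] compact_simplex[OF simp\<tau>] by metis
    qed
    moreover have "v / 8 ^ m \<le> measure lborel \<rho>" "measure lborel \<rho> \<le> V / 8 ^ m"
      using refined_content[OF BEK v \<rho>(1,2)] by auto
    ultimately show ?thesis using Suc by simp
  qed
  then show "v / 8 ^ level \<T> \<tau> \<le> measure lborel \<tau>" "measure lborel \<tau> \<le> 8 * V / 8 ^ level \<T> \<tau>"
    by (simp_all add: L_def)
qed

section \<open>Volumes of stars\<close>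

lemma content_bounds_initial:
  assumes "BEK_sequence \<Omega> \<T>"
  obtains v V where "0 < v" "0 < V" "\<And>\<tau>. \<tau> \<in> \<T> 0 \<Longrightarrow> v \<le> measure lborel \<tau> \<and> measure lborel \<tau> \<le> V"
proof -
  \<comment> \<open>The extra element 1 makes the set nonempty, so that minimum and maximum are
    attained; it can only weaken the bounds.\<close>
  let ?A = "insert 1 (measure lborel ` \<T> 0)"
  have fin: "finite ?A" using BEK_sequenceD(2)[OF assms] by simp
  have pos: "\<And>x. x \<in> ?A \<Longrightarrow> 0 < x"
    using BEK_sequenceD(4)[OF assms] simplex_content_pos(2) by auto
  have "0 < Min ?A" "0 < Max ?A" using fin pos Min_in[of ?A] Max_in[of ?A] by blast+
  then show ?thesis by (rule that) (use fin in auto)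
qed

text \<open>There are no hanging nodes: a corner of \<sigma> lying in \<tau> is extreme in the
  common face, and extreme points of a face of \<tau> are corners of \<tau>. This links
  \<open>node_level\<close>, taken over tetrahedra containing a node, to
  \<open>star_volume\<close>.\<close>

lemma conforming_corner:
  assumes conf: "conforming \<S>" and "v \<in> nodes \<S>" "\<tau> \<in> \<S>" "v \<in> \<tau>"
  shows "v \<in> corners \<tau>"
proof -
  obtain \<sigma> where \<sigma>: "\<sigma> \<in> \<S>" "v extreme_point_of \<sigma>"
    using assms(2) by (auto simp: nodes_def corners_def)
  then have "v \<in> \<sigma> \<inter> \<tau>" using \<open>v \<in> \<tau>\<close> by (auto simp: extreme_point_of_def)
  moreover have "(\<sigma> \<inter> \<tau>) face_of \<sigma>" "(\<sigma> \<inter> \<tau>) face_of \<tau>"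
    using conf \<sigma>(1) \<open>\<tau> \<in> \<S>\<close> by (auto simp: conforming_def)
  ultimately show ?thesis using \<sigma>(2) extreme_point_of_face by (simp add: corners_def) blast
qed

text \<open>No counting of the tetrahedra at \<open>x\<close> is needed for the upper bound: they have pairwise
  disjoint interiors and lie in a common ball of radius proportional to \<open>2 powr - node_level \<T> j x\<close>.\<close>
lemma star_volume_level:
  assumes BEK: "BEK_sequence \<Omega> \<T>"
  shows "\<exists>c C. 0 < c \<and> 0 < C \<and> (\<forall>j. \<forall>x\<in>nodes (\<T> j).
    c \<le> 8 ^ node_level \<T> j x * star_volume (\<T> j) x \<and>
    8 ^ node_level \<T> j x * star_volume (\<T> j) x \<le> C)"
proof -
  obtain v V where v: "0 < v" "0 < V" and init: "\<And>\<tau>. \<tau> \<in> \<T> 0 \<Longrightarrow> v \<le> measure lborel \<tau> \<and> measure lborel \<tau> \<le> V"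
    by (rule content_bounds_initial[OF BEK]) blast
  have level_bounds: "v / 8 ^ level \<T> \<tau> \<le> measure lborel \<tau>"
    "measure lborel \<tau> \<le> 8 * V / 8 ^ level \<T> \<tau>" if "\<tau> \<in> \<T> j" for j \<tau>
    using content_level[OF BEK _ less_imp_le[OF v(1)] that] init by blast+
  have "shape_regular (\<Union>j. \<T> j)" using BEK by (simp add: BEK_sequence_def)
  moreover have "3 simplex \<tau>" if "\<tau> \<in> (\<Union>j. \<T> j)" for \<tau>
    using that BEK_sequenceD(4)[OF BEK] by auto
  ultimately have "\<exists>K>0. \<forall>\<tau>\<in>(\<Union>j. \<T> j). \<exists>r\<ge>0. r ^ 3 \<le> K * measure lborel \<tau> \<and> (\<forall>v\<in>corners \<tau>. \<tau> \<subseteq> cball v r)"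
    by (rule shape_regular_ball_bound)
  then obtain K where K: "0 < K"
    and ball: "\<And>j \<tau>. \<tau> \<in> \<T> j \<Longrightarrow> \<exists>r\<ge>0. r ^ 3 \<le> K * measure lborel \<tau> \<and> (\<forall>v\<in>corners \<tau>. \<tau> \<subseteq> cball v r)"
    by (metis UN_I UNIV_I)
  define \<omega> where "\<omega> = measure lborel (ball (0 :: real^3) 1)"
  have \<omega>: "0 < \<omega>" by (simp add: \<omega>_def content_ball_pos)
  have "v \<le> 8 ^ node_level \<T> j x * star_volume (\<T> j) x \<and>
    8 ^ node_level \<T> j x * star_volume (\<T> j) x \<le> K * (8 * V) * \<omega>" if x: "x \<in> nodes (\<T> j)" for j x
  proof -
    define L where "L = node_level \<T> j x"
    define S where "S = {\<tau> \<in> \<T> j. x \<in> corners \<tau>}"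
    have fin: "finite (\<T> j)" using BEK_sequenceD(2)[OF BEK] .
    have S: "finite S" "\<And>\<tau>. \<tau> \<in> S \<Longrightarrow> \<tau> \<in> \<T> j" "\<And>\<tau>. \<tau> \<in> S \<Longrightarrow> x \<in> corners \<tau>"
      using fin by (auto simp: S_def)
    have mem: "x \<in> \<tau>" if "x \<in> corners \<tau>" for \<tau> using that by (auto simp: corners_def extreme_point_of_def)
    let ?A = "{\<tau> \<in> \<T> j. x \<in> \<tau>}"
    have A: "finite ?A" "?A \<noteq> {}" using fin x mem by (auto simp: nodes_def)
    \<comment> \<open>A tetrahedron attaining the minimal level; its volume alone gives the lower
      bound.\<close>
    have "L \<in> level \<T> ` ?A" unfolding L_def node_level_def using A by (intro Min_in) auto
    then obtain \<tau>0 where \<tau>0: "\<tau>0 \<in> \<T> j" "x \<in> \<tau>0" "level \<T> \<tau>0 = L" by auto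
    have "\<tau>0 \<in> S"
      using conforming_corner[OF BEK_sequenceD(3)[OF BEK] x \<tau>0(1,2)] \<tau>0 by (simp add: S_def)
    have "v / 8 ^ L \<le> measure lborel \<tau>0" using level_bounds(1)[OF \<tau>0(1)] \<tau>0(3) by simp
    also have "\<dots> \<le> star_volume (\<T> j) x"
      unfolding star_volume_def S_def[symmetric] using S(1) \<open>\<tau>0 \<in> S\<close> by (intro member_le_sum) auto
    finally have lower: "v \<le> 8 ^ L * star_volume (\<T> j) x" by (simp add: divide_le_eq mult.commute)
    \<comment> \<open>The largest radius that \<open>ball\<close> permits for a tetrahedron of level
      at least \<open>L\<close>, whose volume is at most \<open>8 * V / 8 ^ L\<close>.\<close>
    define R where "R = root 3 (K * (8 * V) / 8 ^ L)"
    have R: "0 \<le> R" "R ^ 3 = K * (8 * V) / 8 ^ L" using K v by (simp_all add: R_def)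
    have sub: "\<tau> \<subseteq> cball x R" if "\<tau> \<in> S" for \<tau>
    proof -
      obtain r where r: "r ^ 3 \<le> K * measure lborel \<tau>" "\<tau> \<subseteq> cball x r"
        using ball[OF S(2)[OF \<open>\<tau> \<in> S\<close>]] S(3)[OF \<open>\<tau> \<in> S\<close>] by blast
      have "L \<le> level \<T> \<tau>"
        unfolding L_def node_level_def using A(1) S(2,3)[OF that] mem by (intro Min_le) auto
      then have "8 * V / 8 ^ level \<T> \<tau> \<le> 8 * V / 8 ^ L"
        using v by (intro divide_left_mono power_increasing) auto
      then have "measure lborel \<tau> \<le> 8 * V / 8 ^ L"
        using level_bounds(2)[OF S(2)[OF that]] by linarith
      then have "K * measure lborel \<tau> \<le> K * (8 * V / 8 ^ L)" using K by (intro mult_left_mono) auto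
      then have "r ^ 3 \<le> R ^ 3" using r(1) R(2) by simp
      then have "r \<le> R" using R(1) by (metis power_le_imp_le_base eval_nat_numeral(3))
      then show ?thesis using r(2) subset_cball by blast
    qed
    have comp: "compact \<tau>" if "\<tau> \<in> S" for \<tau>
      using BEK_sequenceD(4)[OF BEK S(2)[OF that]] by (rule compact_simplex)
    have "star_volume (\<T> j) x = (\<Sum>\<tau>\<in>S. measure lebesgue \<tau>)"
      unfolding star_volume_def S_def[symmetric] by (intro sum.cong refl) (simp add: measure_lebesgue_compact comp)
    also have "\<dots> = measure lebesgue (\<Union>S)"
    proof (rule measure_negligible_finite_Union[symmetric, OF S(1)])
      show "\<And>\<tau>. \<tau> \<in> S \<Longrightarrow> \<tau> \<in> lmeasurable" using comp by (rule lmeasurable_compact)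
      show "pairwise (\<lambda>S T. negligible (S \<inter> T)) S"
        using tetrahedra_overlap_negligible[OF BEK_sequenceD(1)[OF BEK]]
        by (rule pairwise_subset) (use S in auto)
    qed
    also have "\<dots> \<le> measure lebesgue (cball x R)"
    proof (rule measure_mono_fmeasurable)
      show "\<Union>S \<subseteq> cball x R" using sub by blast
      have "compact (\<Union>S)" using S(1) comp by (rule compact_Union)
      then show "\<Union>S \<in> sets lebesgue" by (intro fmeasurableD lmeasurable_compact)
    qed (intro lmeasurable_compact compact_cball)
    also have "\<dots> = measure lborel (ball x R)"
      by (simp add: measure_lebesgue_compact content_cball_conv_ball)
    \<comment> \<open>Ball volumes scale with the cube of the radius, and the denominator of
      \<open>R ^ 3\<close> cancels \<open>8 ^ L\<close>.\<close>
    also have "\<dots> = R ^ 3 * \<omega>"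
      using content_ball_conv_unit_ball[OF R(1), of x] by (simp add: \<omega>_def)
    finally have "8 ^ L * star_volume (\<T> j) x \<le> K * (8 * V) * \<omega>"
      by (simp add: R(2) field_simps)
    with lower show ?thesis by (simp add: L_def)
  qed
  then show ?thesis
    using v K \<omega> by (intro exI[of _ v] exI[of _ "K * (8 * V) * \<omega>"]) auto
qed

subsection \<open>The scaled basis\<close>

lemma fe_space_sum:
  assumes "finite I" "\<And>i. i \<in> I \<Longrightarrow> \<psi> i \<in> fe_space \<Omega> \<S>"
  shows "(\<lambda>y. \<Sum>i\<in>I. c i * \<psi> i y) \<in> fe_space \<Omega> \<S>"
proof -
  have "continuous_on (closure \<Omega>) (\<lambda>y. \<Sum>i\<in>I. c i * \<psi> i y)"
    using assms by (intro continuous_intros) (auto simp: fe_space_def)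
  moreover have "\<exists>a b. \<forall>x\<in>\<tau>. (\<Sum>i\<in>I. c i * \<psi> i x) = a \<bullet> x + b" if "\<tau> \<in> \<S>" for \<tau>
  proof -
    have "\<forall>i\<in>I. \<exists>a b. \<forall>x\<in>\<tau>. \<psi> i x = a \<bullet> x + b"
      using assms(2) that by (auto simp: fe_space_def)
    then obtain a b where ab: "\<And>i x. i \<in> I \<Longrightarrow> x \<in> \<tau> \<Longrightarrow> \<psi> i x = a i \<bullet> x + b i" by metis
    have "(\<Sum>i\<in>I. c i * \<psi> i x) = (\<Sum>i\<in>I. c i *\<^sub>R a i) \<bullet> x + (\<Sum>i\<in>I. c i * b i)" if "x \<in> \<tau>" for x
    proof -
      have "(\<Sum>i\<in>I. c i * \<psi> i x) = (\<Sum>i\<in>I. (c i *\<^sub>R a i) \<bullet> x + c i * b i)"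
        using ab that by (intro sum.cong) (auto simp: distrib_left)
      then show ?thesis by (simp add: sum.distrib inner_sum_left)
    qed
    then show ?thesis by blast
  qed
  moreover have "(\<Sum>i\<in>I. c i * \<psi> i x) = 0" if "x \<in> frontier \<Omega>" for x
    using that assms(2) by (intro sum.neutral) (auto simp: fe_space_def)
  ultimately show ?thesis by (simp add: fe_space_def)
qed

text \<open>The Kronecker property leaves one term at an interior node and none at a boundary node,
  so boundary nodes drop out of sums over all nodes.\<close>

lemma nodal_basis_sum_at_node:
  assumes "nodal_basis \<Omega> \<S> \<psi>" "finite (nodes \<S>)" "y \<in> nodes \<S>"
  shows "(\<Sum>x\<in>interior_nodes \<Omega> \<S>. c x * \<psi> x y) = (if y \<in> interior_nodes \<Omega> \<S> then c y else 0)"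
proof -
  have "c x * \<psi> x y = (if y = x then c x else 0)" if "x \<in> interior_nodes \<Omega> \<S>" for x
    using that assms(1,3) unfolding nodal_basis_def by auto
  then have "(\<Sum>x\<in>interior_nodes \<Omega> \<S>. c x * \<psi> x y) = (\<Sum>x\<in>interior_nodes \<Omega> \<S>. if y = x then c x else 0)"
    by (intro sum.cong) auto
  then show ?thesis using assms(2) by (simp add: interior_nodes_def)
qed

text \<open>The exponent 3/2 is half the dimension, so the squared scaling factor is the inverse of
  the order of volumes at level \<open>n\<close>.\<close>

lemma two_powr_three_halves_square: "(2 powr (3/2 * real n))\<^sup>2 = 8 ^ n"
proof -
  have "(2 powr (3/2 * real n))\<^sup>2 = 2 powr (real (3 * n))"
    by (simp add: power2_eq_square powr_add[symmetric])
  also have "\<dots> = 2 ^ (3 * n)" by (rule powr_realpow) simp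
  finally show ?thesis by (simp add: power_mult)
qed

theorem mainTheorem5:
  fixes \<Omega> :: "(real^3) set"
    and \<T> :: "nat \<Rightarrow> (real^3) set set"
    and \<phi> :: "nat \<Rightarrow> real^3 \<Rightarrow> real^3 \<Rightarrow> real"
  assumes "polyhedral_domain \<Omega>"
    and "BEK_sequence \<Omega> \<T>"
    and "\<And>j. nodal_basis \<Omega> (\<T> j) (\<phi> j)"
  shows "\<exists>c C. 0 < c \<and> 0 < C \<and>
    (\<forall>j. \<forall>u :: real^3 \<Rightarrow> real.
       c * L2_set u (interior_nodes \<Omega> (\<T> j))
         \<le> L2_norm \<Omega> (\<lambda>y. \<Sum>x\<in>interior_nodes \<Omega> (\<T> j). u x * scaled_basis \<T> \<phi> j x y) \<and>
       L2_norm \<Omega> (\<lambda>y. \<Sum>x\<in>interior_nodes \<Omega> (\<T> j). u x * scaled_basis \<T> \<phi> j x y)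
         \<le> C * L2_set u (interior_nodes \<Omega> (\<T> j)))"
proof -
  obtain c C where c: "0 < c" "0 < C" and star: "\<And>j x. x \<in> nodes (\<T> j) \<Longrightarrow>
      c \<le> 8 ^ node_level \<T> j x * star_volume (\<T> j) x \<and> 8 ^ node_level \<T> j x * star_volume (\<T> j) x \<le> C"
    using star_volume_level[OF assms(2)] by blast
  \<comment> \<open>\<open>c\<close> and \<open>C\<close> bound the scaled star volumes and 1024
    comes from \<open>L2_norm_fe_bounds\<close>; roots appear because these bounds concern squared
    norms.\<close>
  have "sqrt (c / 1024) * L2_set u (interior_nodes \<Omega> (\<T> j))
         \<le> L2_norm \<Omega> (\<lambda>y. \<Sum>x\<in>interior_nodes \<Omega> (\<T> j). u x * scaled_basis \<T> \<phi> j x y) \<and>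
       L2_norm \<Omega> (\<lambda>y. \<Sum>x\<in>interior_nodes \<Omega> (\<T> j). u x * scaled_basis \<T> \<phi> j x y)
         \<le> sqrt C * L2_set u (interior_nodes \<Omega> (\<T> j))" for j u
  proof -
    let ?I = "interior_nodes \<Omega> (\<T> j)" and ?N = "nodes (\<T> j)"
    \<comment> \<open>Absorbing the scaling into the coefficients leaves a plain nodal expansion,
      whose value at an interior node \<open>y\<close> is \<open>s y\<close>.\<close>
    define s where "s x = u x * 2 powr (3/2 * real (node_level \<T> j x))" for x
    define f where "f y = (\<Sum>x\<in>?I. s x * \<phi> j x y)" for y
    have f: "(\<lambda>y. \<Sum>x\<in>?I. u x * scaled_basis \<T> \<phi> j x y) = f"
      by (simp add: fun_eq_iff f_def s_def scaled_basis_def mult.assoc)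
    have mesh: "tetrahedral_mesh (closure \<Omega>) (\<T> j)" by (rule BEK_sequenceD(1)[OF assms(2)])
    have fin: "finite ?N" by (rule finite_nodes[OF mesh])
    have I: "?I \<subseteq> ?N" "finite ?I" using fin by (auto simp: interior_nodes_def)
    have "f \<in> fe_space \<Omega> (\<T> j)"
      using fe_space_sum[OF I(2), of "\<phi> j"] assms(3) unfolding f_def nodal_basis_def by auto
    note bounds = L2_norm_fe_bounds[OF assms(1) mesh this]
    \<comment> \<open>\<open>f\<close> vanishes at the boundary nodes, so only interior nodes
      contribute.\<close>
    have "(\<Sum>y\<in>?N. (f y)\<^sup>2 * star_volume (\<T> j) y) = (\<Sum>y\<in>?I. (s y)\<^sup>2 * star_volume (\<T> j) y)"
      using nodal_basis_sum_at_node[OF assms(3) fin, of _ s] I fin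
      by (intro sum.mono_neutral_cong_right) (auto simp: f_def)
    also have "\<dots> = (\<Sum>y\<in>?I. (u y)\<^sup>2 * (8 ^ node_level \<T> j y * star_volume (\<T> j) y))"
      by (simp only: s_def power_mult_distrib two_powr_three_halves_square mult.assoc)
    finally have eq: "(\<Sum>y\<in>?N. (f y)\<^sup>2 * star_volume (\<T> j) y) = \<dots>" .
    have L2: "(L2_set u ?I)\<^sup>2 = (\<Sum>y\<in>?I. (u y)\<^sup>2)" by (simp add: L2_set_def sum_nonneg)
    have "c * (L2_set u ?I)\<^sup>2 \<le> (\<Sum>y\<in>?I. (u y)\<^sup>2 * (8 ^ node_level \<T> j y * star_volume (\<T> j) y))"
      unfolding L2 sum_distrib_left
    proof (rule sum_mono)
      fix y assume "y \<in> ?I"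
      then have "c \<le> 8 ^ node_level \<T> j y * star_volume (\<T> j) y" using star I by blast
      then show "c * (u y)\<^sup>2 \<le> (u y)\<^sup>2 * (8 ^ node_level \<T> j y * star_volume (\<T> j) y)"
        by (subst mult.commute) (rule mult_left_mono, simp_all)
    qed
    then have "(sqrt (c / 1024) * L2_set u ?I)\<^sup>2 \<le> (L2_norm \<Omega> f)\<^sup>2"
      using bounds(1) c unfolding eq by (simp add: power_mult_distrib)
    moreover have "(L2_norm \<Omega> f)\<^sup>2 \<le> (sqrt C * L2_set u ?I)\<^sup>2"
    proof -
      have "(\<Sum>y\<in>?I. (u y)\<^sup>2 * (8 ^ node_level \<T> j y * star_volume (\<T> j) y)) \<le> C * (L2_set u ?I)\<^sup>2"
        unfolding L2 sum_distrib_left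
      proof (rule sum_mono)
        fix y assume "y \<in> ?I"
        then have "8 ^ node_level \<T> j y * star_volume (\<T> j) y \<le> C" using star I by blast
        then show "(u y)\<^sup>2 * (8 ^ node_level \<T> j y * star_volume (\<T> j) y) \<le> C * (u y)\<^sup>2"
          by (subst (2) mult.commute) (rule mult_left_mono, simp_all)
      qed
      then show ?thesis using bounds(2) c unfolding eq by (simp add: power_mult_distrib)
    qed
    \<comment> \<open>With the larger sides nonnegative, the inequalities between squares pass to
      the norms.\<close>
    moreover have "0 \<le> L2_norm \<Omega> f"
      by (simp add: L2_norm_def set_lebesgue_integral_def)
    ultimately show ?thesis
      unfolding f using c L2_set_nonneg[of u ?I]
      by (meson mult_nonneg_nonneg power2_le_imp_le real_sqrt_ge_zero less_imp_le)
  qed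
  then show ?thesis
    using c by (intro exI[of _ "sqrt (c / 1024)"] exI[of _ "sqrt C"]) auto
qed

end
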